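(* Let $X$ and $Z$ be complex manifolds of complex dimension $m+k$ and $k$ respectively, $\Psi:X\to Z$ a holomorphic submersion, $N$ a smooth manifold and $\varphi:N\to X$ a maximally totally real immersion. Let $\psi:=\Psi\circ\varphi$ and let $\psi_*:\mathbb{C}TN\to\mathbb{C}TZ$ be the induced map. Then $P:=\psi_*^{-1}(T^{1,0}Z)\subset\mathbb{C}TN$ defines an involutive structure on $N$ of rank $m$.
   Context: $\mathbb{C}TN=TN\otimes\mathbb{C}$. An immersion $\varphi:N\to X$ into a complex manifold (with almost complex tensor $J$) is maximally totally real if for every $p\in N$ the subspace $\varphi_*(T_pN)\subset T_{\varphi(p)}X$ is totally real (i.e. $\varphi_*(T_pN)\cap J\varphi_*(T_pN)=\{0\}$) and $\dim_{\mathbb{R}}N=\dim_{\mathbb{C}}X$. An involutive structure on a smooth manifold $N$ is a smooth complex subbundle $P$ of $\mathbb{C}TN$ such that the Lie bracket of local smooth sections of $P$ is again a section of $P$; its rank is the complex rank. *)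

theory Defs
  imports "HOL-Analysis.Analysis"
begin

subsection \<open>Model spaces\<close>

text \<open>
  Manifolds are modelled on finite-dimensional real inner product spaces. Unlike
  \<^class>\<open>euclidean_space\<close>, the class below also admits the zero space, so that manifolds of
  dimension 0 are covered. The inner product is only used for its topology.
\<close>

class finite_dim_inner = real_inner +
  assumes finite_spanning: "\<exists>B. finite B \<and> (\<forall>x. \<exists>r. x = (\<Sum>b\<in>B. r b *\<^sub>R b))"

instance euclidean_space \<subseteq> finite_dim_inner
proof
  show "\<exists>B::'a set. finite B \<and> (\<forall>x. \<exists>r. x = (\<Sum>b\<in>B. r b *\<^sub>R b))"
  proof (intro exI[of _ Basis] conjI allI)
    fix x :: 'a
    show "\<exists>r. x = (\<Sum>b\<in>Basis. r b *\<^sub>R b)"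
      by (rule exI[of _ "\<lambda>b. inner x b"]) (simp add: euclidean_representation)
  qed simp
qed

text \<open>A finite-dimensional complex vector space, given by multiplication by the imaginary unit.\<close>

class complex_model = finite_dim_inner +
  fixes imult :: "'a \<Rightarrow> 'a"
  assumes imult_add: "imult (x + y) = imult x + imult y"
    and imult_scaleR: "imult (r *\<^sub>R x) = r *\<^sub>R imult x"
    and imult_imult: "imult (imult x) = - x"

text \<open>The spaces \<open>\<complex>\<^sup>n\<close> for positive \<open>n\<close>, and \<open>\<complex>\<^sup>0\<close>.\<close>


instantiation complex :: complex_model
begin
definition "imult z = \<i> * (z::complex)"
instance by standard (simp_all add: imult_complex_def algebra_simps)
end

instantiation vec :: ("{complex_model, euclidean_space}", finite) complex_model
begin
definition "imult v = (\<chi> i. imult (v $ i))"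
instance by standard (simp_all add: imult_vec_def vec_eq_iff imult_add imult_scaleR imult_imult)
end

instantiation unit :: complex_model
begin
definition "(0::unit) = ()"
definition "(x::unit) + y = ()"
definition "(r::real) *\<^sub>R (x::unit) = ()"
definition "norm (x::unit) = 0"
definition "dist (x::unit) y = 0"
definition "sgn (x::unit) = ()"
definition "inner (x::unit) y = 0"
definition "imult (x::unit) = ()"
definition "(uniformity :: (unit \<times> unit) filter) = (INF e\<in>{0<..}. principal {(x, y). dist x y < e})"
definition "open (U :: unit set) = (\<forall>x\<in>U. eventually (\<lambda>(x', y). x' = x \<longrightarrow> y \<in> U) uniformity)"
instance
  by standard
    (simp_all add: zero_unit_def scaleR_unit_def norm_unit_def dist_unit_def inner_unit_def
      uniformity_unit_def open_unit_def)
end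

subsection \<open>Smooth and holomorphic maps between model spaces\<close>

primrec Ck_on ::
  "nat \<Rightarrow> 'a::real_normed_vector set \<Rightarrow> ('a \<Rightarrow> 'b::real_normed_vector) \<Rightarrow> bool" where
  "Ck_on 0 S f \<longleftrightarrow> continuous_on S f"
| "Ck_on (Suc n) S f \<longleftrightarrow> (\<forall>x\<in>S. f differentiable (at x)) \<and>
     (\<forall>v. Ck_on n S (\<lambda>x. frechet_derivative f (at x) v))"

text \<open>Only used for open \<open>S\<close> in a finite-dimensional space.\<close>

definition smooth_on :: "'a::real_normed_vector set \<Rightarrow> ('a \<Rightarrow> 'b::real_normed_vector) \<Rightarrow> bool" where
  "smooth_on S f \<longleftrightarrow> (\<forall>n. Ck_on n S f)"

text \<open>Holomorphic: smooth, with complex-linear derivative (the Cauchy-Riemann equations).\<close>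

definition holo_on :: "'a::complex_model set \<Rightarrow> ('a \<Rightarrow> 'b::complex_model) \<Rightarrow> bool" where
  "holo_on S f \<longleftrightarrow> smooth_on S f \<and>
     (\<forall>x\<in>S. \<forall>v. frechet_derivative f (at x) (imult v) = imult (frechet_derivative f (at x) v))"

subsection \<open>Manifolds\<close>

text \<open>
  A chart is a pair of its domain and its coordinate map. A manifold is a Hausdorff, second
  countable topological space, which is the whole type \<open>'a\<close>, together with an atlas.
\<close>

type_synonym ('a, 'e) chart = "'a set \<times> ('a \<Rightarrow> 'e)"

definition chart_inv :: "('a, 'e) chart \<Rightarrow> 'e \<Rightarrow> 'a" where
  "chart_inv c = inv_into (fst c) (snd c)"

definition charts_at :: "('a, 'e) chart set \<Rightarrow> 'a \<Rightarrow> ('a, 'e) chart set" where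
  "charts_at A p = {c \<in> A. p \<in> fst c}"

definition top_atlas :: "('a::topological_space, 'e::real_normed_vector) chart set \<Rightarrow> bool" where
  "top_atlas A \<longleftrightarrow>
     (\<forall>c\<in>A. open (fst c) \<and> open (snd c ` fst c) \<and>
        homeomorphism (fst c) (snd c ` fst c) (snd c) (chart_inv c)) \<and>
     (\<forall>p. charts_at A p \<noteq> {})"

text \<open>The coordinate expression of a map, and the set on which it is defined.\<close>

definition coord_rep :: "('a, 'e) chart \<Rightarrow> ('b, 'f) chart \<Rightarrow> ('a \<Rightarrow> 'b) \<Rightarrow> 'e \<Rightarrow> 'f" where
  "coord_rep c d f = snd d \<circ> f \<circ> chart_inv c"

definition coord_dom :: "('a, 'e) chart \<Rightarrow> ('b, 'f) chart \<Rightarrow> ('a \<Rightarrow> 'b) \<Rightarrow> 'e set" where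
  "coord_dom c d f = snd c ` (fst c \<inter> f -` fst d)"

definition smooth_manifold ::
  "('a::{t2_space, second_countable_topology}, 'e::finite_dim_inner) chart set \<Rightarrow> bool" where
  "smooth_manifold A \<longleftrightarrow> top_atlas A \<and>
     (\<forall>c\<in>A. \<forall>d\<in>A. smooth_on (coord_dom c d id) (coord_rep c d id))"

definition complex_manifold ::
  "('a::{t2_space, second_countable_topology}, 'e::complex_model) chart set \<Rightarrow> bool" where
  "complex_manifold A \<longleftrightarrow> top_atlas A \<and>
     (\<forall>c\<in>A. \<forall>d\<in>A. holo_on (coord_dom c d id) (coord_rep c d id))"

definition real_dim :: "('a, 'e::finite_dim_inner) chart set \<Rightarrow> nat" where
  "real_dim A = dim (UNIV :: 'e set)"

definition complex_dim :: "('a, 'e::complex_model) chart set \<Rightarrow> nat" where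
  "complex_dim A = real_dim A div 2"

definition smooth_map ::
  "('a::topological_space, 'e::finite_dim_inner) chart set \<Rightarrow>
   ('b::topological_space, 'f::finite_dim_inner) chart set \<Rightarrow> ('a \<Rightarrow> 'b) \<Rightarrow> bool" where
  "smooth_map A B f \<longleftrightarrow> continuous_on UNIV f \<and>
     (\<forall>c\<in>A. \<forall>d\<in>B. smooth_on (coord_dom c d f) (coord_rep c d f))"

definition holomorphic_map ::
  "('a::topological_space, 'e::complex_model) chart set \<Rightarrow>
   ('b::topological_space, 'f::complex_model) chart set \<Rightarrow> ('a \<Rightarrow> 'b) \<Rightarrow> bool" where
  "holomorphic_map A B f \<longleftrightarrow> continuous_on UNIV f \<and>
     (\<forall>c\<in>A. \<forall>d\<in>B. holo_on (coord_dom c d f) (coord_rep c d f))"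

subsection \<open>Tangent vectors\<close>

text \<open>
  A tangent vector at \<open>p\<close> assigns to every chart around \<open>p\<close> its component vector, such that
  components transform by the derivative of the transition map. By convention it is 0 on all
  other charts, so that equality of tangent vectors at \<open>p\<close> is equality of functions. Vector
  space operations are chartwise.
\<close>

type_synonym ('a, 'e) tvec = "('a, 'e) chart \<Rightarrow> 'e"

definition tangent_space ::
  "('a, 'e::real_normed_vector) chart set \<Rightarrow> 'a \<Rightarrow> ('a, 'e) tvec set" where
  "tangent_space A p = {v.
     (\<forall>c\<in>charts_at A p. \<forall>d\<in>charts_at A p.
        v d = frechet_derivative (coord_rep c d id) (at (snd c p)) (v c)) \<and>
     (\<forall>c. c \<notin> charts_at A p \<longrightarrow> v c = 0)}"

text \<open>The differential; it does not depend on the chart \<open>c\<close> chosen around \<open>p\<close>.\<close>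

definition pushforward ::
  "('a, 'e::real_normed_vector) chart set \<Rightarrow> ('b, 'f::real_normed_vector) chart set \<Rightarrow>
   ('a \<Rightarrow> 'b) \<Rightarrow> 'a \<Rightarrow> ('a, 'e) tvec \<Rightarrow> ('b, 'f) tvec" where
  "pushforward A B f p v = (\<lambda>d. if d \<in> charts_at B (f p)
     then (let c = (SOME c. c \<in> charts_at A p)
           in frechet_derivative (coord_rep c d f) (at (snd c p)) (v c))
     else 0)"

definition almost_complex :: "('a, 'e::complex_model) tvec \<Rightarrow> ('a, 'e) tvec" where
  "almost_complex v = (\<lambda>c. imult (v c))"

definition holomorphic_submersion ::
  "('a::topological_space, 'e::complex_model) chart set \<Rightarrow>
   ('b::topological_space, 'f::complex_model) chart set \<Rightarrow> ('a \<Rightarrow> 'b) \<Rightarrow> bool" where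
  "holomorphic_submersion A B f \<longleftrightarrow> holomorphic_map A B f \<and>
     (\<forall>p. pushforward A B f p ` tangent_space A p = tangent_space B (f p))"

definition immersion ::
  "('a::topological_space, 'e::finite_dim_inner) chart set \<Rightarrow>
   ('b::topological_space, 'f::finite_dim_inner) chart set \<Rightarrow> ('a \<Rightarrow> 'b) \<Rightarrow> bool" where
  "immersion A B f \<longleftrightarrow> smooth_map A B f \<and>
     (\<forall>p. inj_on (pushforward A B f p) (tangent_space A p))"

definition totally_real :: "('a, 'e::complex_model) tvec set \<Rightarrow> bool" where
  "totally_real V \<longleftrightarrow> V \<inter> almost_complex ` V = {\<lambda>_. 0}"

definition maximally_totally_real_immersion ::
  "('a::topological_space, 'e::finite_dim_inner) chart set \<Rightarrow>
   ('b::topological_space, 'f::complex_model) chart set \<Rightarrow> ('a \<Rightarrow> 'b) \<Rightarrow> bool" where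
  "maximally_totally_real_immersion A B f \<longleftrightarrow> immersion A B f \<and>
     (\<forall>p. totally_real (pushforward A B f p ` tangent_space A p)) \<and>
     real_dim A = complex_dim B"

subsection \<open>The complexified tangent bundle\<close>

text \<open>The pair \<open>(a, b)\<close> of real tangent vectors represents \<open>a + \<i> b\<close>.\<close>

type_synonym ('a, 'e) ctvec = "('a, 'e) tvec \<times> ('a, 'e) tvec"

definition ctangent_space ::
  "('a, 'e::real_normed_vector) chart set \<Rightarrow> 'a \<Rightarrow> ('a, 'e) ctvec set" where
  "ctangent_space A p = tangent_space A p \<times> tangent_space A p"

definition ctscale :: "complex \<Rightarrow> ('a, 'e::real_vector) ctvec \<Rightarrow> ('a, 'e) ctvec" where
  "ctscale z w = (\<lambda>c. Re z *\<^sub>R fst w c - Im z *\<^sub>R snd w c, \<lambda>c. Im z *\<^sub>R fst w c + Re z *\<^sub>R snd w c)"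

definition ctzero :: "('a, 'e::real_vector) ctvec" where
  "ctzero = (\<lambda>_. 0, \<lambda>_. 0)"

definition ctlincomb ::
  "nat \<Rightarrow> (nat \<Rightarrow> complex) \<Rightarrow> (nat \<Rightarrow> ('a, 'e::real_vector) ctvec) \<Rightarrow> ('a, 'e) ctvec" where
  "ctlincomb r z w = (\<lambda>c. \<Sum>i<r. fst (ctscale (z i) (w i)) c, \<lambda>c. \<Sum>i<r. snd (ctscale (z i) (w i)) c)"

definition cpushforward ::
  "('a, 'e::real_normed_vector) chart set \<Rightarrow> ('b, 'f::real_normed_vector) chart set \<Rightarrow>
   ('a \<Rightarrow> 'b) \<Rightarrow> 'a \<Rightarrow> ('a, 'e) ctvec \<Rightarrow> ('b, 'f) ctvec" where
  "cpushforward A B f p w = (pushforward A B f p (fst w), pushforward A B f p (snd w))"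

text \<open>The \<open>\<i>\<close>-eigenspace of the complex-linear extension of the almost complex tensor.\<close>

definition T10 :: "('a, 'e::complex_model) chart set \<Rightarrow> 'a \<Rightarrow> ('a, 'e) ctvec set" where
  "T10 A p = {w \<in> ctangent_space A p.
     (almost_complex (fst w), almost_complex (snd w)) = ctscale \<i> w}"

subsection \<open>Subbundles and involutive structures\<close>

definition smooth_tfield ::
  "('a, 'e::finite_dim_inner) chart set \<Rightarrow> 'a set \<Rightarrow> ('a \<Rightarrow> ('a, 'e) tvec) \<Rightarrow> bool" where
  "smooth_tfield A U V \<longleftrightarrow>
     (\<forall>c\<in>A. smooth_on (snd c ` (U \<inter> fst c)) (\<lambda>x. V (chart_inv c x) c))"

definition smooth_csection ::
  "('a, 'e::finite_dim_inner) chart set \<Rightarrow> ('a \<Rightarrow> ('a, 'e) ctvec set) \<Rightarrow> 'a set \<Rightarrow>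
   ('a \<Rightarrow> ('a, 'e) ctvec) \<Rightarrow> bool" where
  "smooth_csection A P U V \<longleftrightarrow> (\<forall>q\<in>U. V q \<in> P q) \<and>
     smooth_tfield A U (\<lambda>q. fst (V q)) \<and> smooth_tfield A U (\<lambda>q. snd (V q))"

text \<open>A smooth complex subbundle of rank \<open>r\<close>: locally spanned by a smooth frame of length \<open>r\<close>.\<close>

definition smooth_csubbundle ::
  "('a::topological_space, 'e::finite_dim_inner) chart set \<Rightarrow> ('a \<Rightarrow> ('a, 'e) ctvec set) \<Rightarrow>
   nat \<Rightarrow> bool" where
  "smooth_csubbundle A P r \<longleftrightarrow>
     (\<forall>p. \<exists>U s. open U \<and> p \<in> U \<and>
        (\<forall>i<r. smooth_csection A (ctangent_space A) U (s i)) \<and>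
        (\<forall>q\<in>U. P q = range (\<lambda>z. ctlincomb r z (\<lambda>i. s i q)) \<and>
           (\<forall>z. ctlincomb r z (\<lambda>i. s i q) = ctzero \<longrightarrow> (\<forall>i<r. z i = 0))))"

text \<open>
  The Lie bracket by the coordinate formula \<open>[V, W] = DW(V) - DV(W)\<close> in each chart, which gives
  the components of a tangent vector; it is then extended complex-bilinearly.
\<close>

definition lie_bracket ::
  "('a, 'e::real_normed_vector) chart set \<Rightarrow> ('a \<Rightarrow> ('a, 'e) tvec) \<Rightarrow> ('a \<Rightarrow> ('a, 'e) tvec) \<Rightarrow>
   'a \<Rightarrow> ('a, 'e) tvec" where
  "lie_bracket A V W p = (\<lambda>c. if c \<in> charts_at A p
     then frechet_derivative (\<lambda>x. W (chart_inv c x) c) (at (snd c p)) (V p c)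
        - frechet_derivative (\<lambda>x. V (chart_inv c x) c) (at (snd c p)) (W p c)
     else 0)"

definition clie_bracket ::
  "('a, 'e::real_normed_vector) chart set \<Rightarrow> ('a \<Rightarrow> ('a, 'e) ctvec) \<Rightarrow> ('a \<Rightarrow> ('a, 'e) ctvec) \<Rightarrow>
   'a \<Rightarrow> ('a, 'e) ctvec" where
  "clie_bracket A V W p =
    (let V1 = (\<lambda>q. fst (V q)); V2 = (\<lambda>q. snd (V q)); W1 = (\<lambda>q. fst (W q)); W2 = (\<lambda>q. snd (W q))
     in (\<lambda>c. lie_bracket A V1 W1 p c - lie_bracket A V2 W2 p c,
         \<lambda>c. lie_bracket A V1 W2 p c + lie_bracket A V2 W1 p c))"

definition involutive_structure ::
  "('a::topological_space, 'e::finite_dim_inner) chart set \<Rightarrow> ('a \<Rightarrow> ('a, 'e) ctvec set) \<Rightarrow>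
   nat \<Rightarrow> bool" where
  "involutive_structure A P r \<longleftrightarrow> smooth_csubbundle A P r \<and>
     (\<forall>U V W. open U \<longrightarrow> smooth_csection A P U V \<longrightarrow> smooth_csection A P U W \<longrightarrow>
        smooth_csection A P U (clie_bracket A V W))"

end

theory Submission
  imports Defs
begin

text \<open>
  Why the theorem holds. In a chart of \<open>N\<close> and a chart of \<open>Z\<close>, let \<open>F\<close> be the coordinate
  expression of \<open>\<psi>\<close> and \<open>J\<close> multiplication by the imaginary unit. The vector
  \<open>\<psi>\<^sub>*(a + \<i> b)\<close> is of type (1,0) exactly if \<open>DF a = J (DF b)\<close>, so \<open>P\<close> is, fibre by fibre, the
  kernel of \<open>L (a, b) = DF a - J (DF b)\<close> (\<open>cpushforward_in_T10_iff\<close>), a real-linear map that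
  turns multiplication by \<open>\<i>\<close> into \<open>- J\<close>.

  Rank. Write \<open>DF = B \<circ> A\<close> with \<open>A\<close> the derivative of \<open>\<phi>\<close> and \<open>B\<close> that of \<open>\<Psi>\<close>. As \<open>B\<close> commutes
  with \<open>J\<close>, we get \<open>L (a, b) = B (A a - J (A b))\<close>. The image of \<open>A\<close> meets its \<open>J\<close>-image only in 0 and
  has half the dimension of the tangent space of \<open>X\<close>, so the vectors \<open>A a - J (A b)\<close> fill that
  space (\<open>totally_real_sum\<close>); \<open>B\<close> is onto because \<open>\<Psi>\<close> is a submersion. Hence \<open>L\<close> is onto at every
  point and its kernel has complex dimension \<open>(m + k) - k = m\<close>.

  Smoothness. The kernels of a smooth family of surjective linear maps have local smooth frames:
  with \<open>R\<close> a right inverse of \<open>L\<close> at one point, the maps \<open>w \<mapsto> w - R ((L R)\<^sup>-\<^sup>1 (L w))\<close> carry a basis of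
  the kernel there to bases of the neighbouring kernels (\<open>smooth_kernel_frame\<close>).

  Involutivity. Symmetry of second derivatives gives
  \<open>DF [v, w] = \<partial>\<^sub>v (DF w) - \<partial>\<^sub>w (DF v)\<close> (\<open>derivative_of_bracket\<close>). Since \<open>J\<close> is constant, relations
  \<open>DF a = J (DF b)\<close> that hold on an open set may be differentiated, and expanding the complex bracket
  bilinearly yields the same relation for its real and imaginary part
  (\<open>antiholomorphic_part_bracket\<close>). The same identity, with a transition map in place of \<open>F\<close>, shows
  that the brackets computed in the individual charts fit together to a tangent vector
  (\<open>lie_bracket_in_tangent_space\<close>).

  Passing between charts rests on two facts: a tangent vector is determined by its component in one
  chart, which can be prescribed, and derivatives of coordinate expressions obey the chain rule
  (\<open>coord_derivative_comp\<close>).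
\<close>

section \<open>Linear algebra of the model spaces\<close>

text \<open>
  Gram-Schmidt orthogonalisation, one vector at a time.
\<close>

lemma finite_set_has_orthonormal_basis:
  fixes S :: "'a::real_inner set"
  assumes "finite S"
  shows "\<exists>B. finite B \<and> (\<forall>b\<in>B. \<forall>c\<in>B. inner b c = (if b = c then 1 else 0)) \<and> S \<subseteq> span B"
  using assms
proof induction
  case empty
  then show ?case by (intro exI[of _ "{}"]) auto
next
  case (insert a S)
  then obtain B where B: "finite B" "\<forall>b\<in>B. \<forall>c\<in>B. inner b c = (if b = c then 1 else 0)"
    "S \<subseteq> span B" by blast
  define a' where "a' = a - (\<Sum>b\<in>B. inner a b *\<^sub>R b)"
  have sum_in: "(\<Sum>b\<in>B. inner a b *\<^sub>R b) \<in> span B"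
    by (intro span_sum span_scale span_base)
  have orth: "inner a' b = 0" if "b \<in> B" for b
  proof -
    have "inner (\<Sum>c\<in>B. inner a c *\<^sub>R c) b = (\<Sum>c\<in>B. if c = b then inner a b else 0)"
      unfolding inner_sum_left by (rule sum.cong) (use B(2) that in auto)
    also have "\<dots> = inner a b"
      using B(1) that by simp
    finally show ?thesis by (simp add: a'_def inner_diff_left)
  qed
  show ?case
  proof (cases "a' = 0")
    case True
    then have "a \<in> span B" using sum_in by (simp add: a'_def)
    then show ?thesis using B by blast
  next
    case False
    define u where "u = (1 / norm a') *\<^sub>R a'"
    have uu: "inner u u = 1"
      using False by (simp add: u_def power2_norm_eq_inner[symmetric] power2_eq_square)
    have ub: "inner u b = 0" "inner b u = 0" if "b \<in> B" for b
      using orth[OF that] by (simp_all add: u_def inner_commute)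
    have "a = norm a' *\<^sub>R u + (\<Sum>b\<in>B. inner a b *\<^sub>R b)"
      using False by (simp add: u_def a'_def)
    moreover have "(\<Sum>b\<in>B. inner a b *\<^sub>R b) \<in> span (insert u B)"
      using sum_in span_mono[of B "insert u B"] by blast
    ultimately have "a \<in> span (insert u B)"
      by (metis span_add span_scale span_base insertI1)
    moreover have "S \<subseteq> span (insert u B)"
      using B(3) span_mono[of B "insert u B"] by blast
    ultimately show ?thesis
      using B(1,2) uu ub by (intro exI[of _ "insert u B"]) auto
  qed
qed

lemma orthonormal_basis_exists:
  "\<exists>B::'a::finite_dim_inner set. finite B \<and>
     (\<forall>b\<in>B. \<forall>c\<in>B. inner b c = (if b = c then 1 else 0)) \<and> span B = UNIV"
proof -
  obtain S :: "'a set" where S: "finite S" "\<And>x. \<exists>r. x = (\<Sum>b\<in>S. r b *\<^sub>R b)"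
    using finite_spanning by blast
  obtain B where B: "finite B" "\<forall>b\<in>B. \<forall>c\<in>B. inner b c = (if b = c then 1 else 0)" "S \<subseteq> span B"
    using finite_set_has_orthonormal_basis[OF S(1)] by blast
  have "x \<in> span B" for x
  proof -
    obtain r where "x = (\<Sum>b\<in>S. r b *\<^sub>R b)" using S(2) by blast
    then show ?thesis using B(3) by (auto intro!: span_sum span_scale)
  qed
  then show ?thesis using B by (intro exI[of _ B]) auto
qed

text \<open>
  A fixed orthonormal basis. Coordinates with respect to it reduce statements about linear maps and
  families of linear maps to finitely many vectors.
\<close>

definition onb :: "'a::finite_dim_inner set" where
  "onb = (SOME B. finite B \<and> (\<forall>b\<in>B. \<forall>c\<in>B. inner b c = (if b = c then 1 else 0)) \<and> span B = UNIV)"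

lemma finite_onb [simp]: "finite (onb :: 'a::finite_dim_inner set)"
  and inner_onb: "\<And>b c::'a. b \<in> onb \<Longrightarrow> c \<in> onb \<Longrightarrow> inner b c = (if b = c then 1 else 0)"
  and span_onb: "span (onb :: 'a set) = UNIV"
  using someI_ex[OF orthonormal_basis_exists[where 'a='a]] unfolding onb_def[symmetric] by auto

lemma onb_expansion: "(\<Sum>b\<in>onb. inner x b *\<^sub>R b) = (x::'a::finite_dim_inner)"
proof -
  have "x \<in> span onb" by (simp add: span_onb)
  then show ?thesis
  proof (induction rule: span_induct_alt)
    case base
    then show ?case by simp
  next
    case (step c b y)
    have "(\<Sum>d\<in>onb. inner b d *\<^sub>R d) = (\<Sum>d\<in>onb. if d = b then b else 0)"
      by (rule sum.cong) (use step.hyps in \<open>auto simp: inner_onb\<close>)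
    also have "\<dots> = b" using step.hyps by simp
    finally have b: "(\<Sum>d\<in>onb. inner b d *\<^sub>R d) = b" .
    have "(\<Sum>d\<in>onb. inner (c *\<^sub>R b + y) d *\<^sub>R d)
        = c *\<^sub>R (\<Sum>d\<in>onb. inner b d *\<^sub>R d) + (\<Sum>d\<in>onb. inner y d *\<^sub>R d)"
      by (simp add: inner_add_left scaleR_add_left sum.distrib scaleR_sum_right)
    then show ?case using b step.IH by simp
  qed
qed

lemma linear_onb_expansion:
  fixes f :: "'a::finite_dim_inner \<Rightarrow> 'b::real_vector"
  assumes "linear f"
  shows "f x = (\<Sum>b\<in>onb. inner x b *\<^sub>R f b)"
proof -
  have "f x = f (\<Sum>b\<in>onb. inner x b *\<^sub>R b)" by (simp add: onb_expansion)
  also have "\<dots> = (\<Sum>b\<in>onb. inner x b *\<^sub>R f b)"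
    by (simp add: linear_sum[OF assms] linear_cmul[OF assms])
  finally show ?thesis .
qed

lemma linear_imp_bounded_linear:
  fixes f :: "'a::finite_dim_inner \<Rightarrow> 'b::real_normed_vector"
  assumes "linear f"
  shows "bounded_linear f"
proof -
  have "bounded_linear (\<lambda>x. \<Sum>b\<in>onb. inner x b *\<^sub>R f b)"
    by (intro bounded_linear_sum bounded_linear_scaleR_const bounded_linear_inner_left)
  moreover have "f = (\<lambda>x. \<Sum>b\<in>onb. inner x b *\<^sub>R f b)"
    using linear_onb_expansion[OF assms] by blast
  ultimately show ?thesis by simp
qed

lemma independent_onb: "independent (onb :: 'a::finite_dim_inner set)"
proof (rule independent_if_scalars_zero[OF finite_onb])
  fix f :: "'a \<Rightarrow> real" and x :: 'a
  assume s: "(\<Sum>x\<in>onb. f x *\<^sub>R x) = 0" and x: "x \<in> onb"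
  have "0 = inner (\<Sum>x\<in>onb. f x *\<^sub>R x) x" by (simp add: s)
  also have "\<dots> = (\<Sum>y\<in>onb. if y = x then f x else 0)"
    unfolding inner_sum_left by (rule sum.cong) (use x in \<open>auto simp: inner_onb\<close>)
  also have "\<dots> = f x" using x by simp
  finally show "f x = 0" by simp
qed

text \<open>
  Fixing a basis puts every model space, including the zero space, under the dimension theory of
  \<^locale>\<open>finite_dimensional_vector_space\<close>.
\<close>

interpretation fin_dim: finite_dimensional_vector_space
  "scaleR :: real \<Rightarrow> 'a \<Rightarrow> 'a::finite_dim_inner" onb
  rewrites "module.dependent (*\<^sub>R) = dependent"
    and "module.representation (*\<^sub>R) = representation"
    and "module.subspace (*\<^sub>R) = subspace"
    and "module.span (*\<^sub>R) = span"
    and "vector_space.extend_basis (*\<^sub>R) = extend_basis"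
    and "vector_space.dim (*\<^sub>R) = dim"
    and "Vector_Spaces.linear (*\<^sub>R) (*\<^sub>R) = linear"
    and "Vector_Spaces.linear (*) (*\<^sub>R) = linear"
proof -
  show "finite_dimensional_vector_space (*\<^sub>R) (onb :: 'a set)"
    by unfold_locales
      (simp_all add: finite_onb independent_onb span_onb
        dependent_raw_def[symmetric] span_raw_def[symmetric])
qed (auto simp add: dependent_raw_def representation_raw_def subspace_raw_def span_raw_def
      extend_basis_raw_def dim_raw_def linear_def real_scaleR_def[abs_def])

interpretation fin_dim_pair: finite_dimensional_vector_space_pair
  "scaleR :: real \<Rightarrow> 'a \<Rightarrow> 'a::finite_dim_inner" onb
  "scaleR :: real \<Rightarrow> 'b \<Rightarrow> 'b::finite_dim_inner" onb
  rewrites "module.dependent (*\<^sub>R) = dependent"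
    and "module.representation (*\<^sub>R) = representation"
    and "module.subspace (*\<^sub>R) = subspace"
    and "module.span (*\<^sub>R) = span"
    and "vector_space.extend_basis (*\<^sub>R) = extend_basis"
    and "vector_space.dim (*\<^sub>R) = dim"
    and "module.dependent (*\<^sub>R) = dependent"
    and "module.representation (*\<^sub>R) = representation"
    and "module.subspace (*\<^sub>R) = subspace"
    and "module.span (*\<^sub>R) = span"
    and "vector_space.extend_basis (*\<^sub>R) = extend_basis"
    and "vector_space.dim (*\<^sub>R) = dim"
    and "Vector_Spaces.linear (*\<^sub>R) (*\<^sub>R) = linear"
proof -
  show "finite_dimensional_vector_space_pair (*\<^sub>R) (onb :: 'a set) (*\<^sub>R) (onb :: 'b set)"
    by unfold_locales
qed (auto simp add: dependent_raw_def representation_raw_def subspace_raw_def span_raw_def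
      extend_basis_raw_def dim_raw_def linear_def real_scaleR_def[abs_def])

text \<open>
  Dimensions stay in the form \<open>dim UNIV\<close>, independent of the chosen basis.
\<close>

declare fin_dim.dim_UNIV [simp del]

text \<open>
  A right inverse \<open>g\<close> splits the domain as the direct sum of the kernel and the range of \<open>g\<close>, and
  \<open>g\<close> is an isomorphism onto the latter.
\<close>

lemma rank_nullity:
  fixes f :: "'a::finite_dim_inner \<Rightarrow> 'b::finite_dim_inner"
  assumes f: "linear f" and surj: "surj f"
  shows "dim (UNIV :: 'a set) = dim {x. f x = 0} + dim (UNIV :: 'b set)"
proof -
  obtain g where g: "linear g" "f \<circ> g = id"
    using linear_surjective_right_inverse[OF f surj] by blast
  have fg: "f (g y) = y" for y using g(2) by (metis comp_apply id_apply)
  have sub: "subspace {x. f x = 0}" "subspace (range g)"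
    using f g(1) by (auto simp: linear_subspace_kernel linear_subspace_image)
  have "x \<in> {u + v |u v. u \<in> {x. f x = 0} \<and> v \<in> range g}" for x
    using f by (intro CollectI exI[of _ "x - g (f x)"] exI[of _ "g (f x)"]) (auto simp: linear_diff fg)
  then have sums: "{u + v |u v. u \<in> {x. f x = 0} \<and> v \<in> range g} = UNIV" by blast
  have int: "{x. f x = 0} \<inter> range g = {0}"
    using f g(1) by (auto simp: fg linear_0 image_iff intro!: exI[of _ 0])
  have "dim (range g) = dim (UNIV :: 'b set)"
    by (rule fin_dim_pair.dim_image_eq[OF g(1)]) (metis fg inj_on_def)
  then show ?thesis
    using fin_dim.dim_sums_Int[OF sub] unfolding sums int by simp
qed

instance prod :: (finite_dim_inner, finite_dim_inner) finite_dim_inner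
proof
  let ?B = "onb \<times> {0} \<union> {0} \<times> onb :: ('a \<times> 'b) set"
  have fin: "finite ?B" by simp
  have "x \<in> span ?B" for x :: "'a \<times> 'b"
  proof -
    have "(\<Sum>b\<in>onb. inner (fst x) b *\<^sub>R (b, 0)) + (\<Sum>b\<in>onb. inner (snd x) b *\<^sub>R (0, b)) \<in> span ?B"
      by (intro span_add span_sum span_scale span_base) auto
    moreover have "(\<Sum>b\<in>onb. inner (fst x) b *\<^sub>R (b, 0::'b)) + (\<Sum>b\<in>onb. inner (snd x) b *\<^sub>R (0::'a, b)) = x"
      by (simp add: prod_eq_iff fst_sum snd_sum onb_expansion)
    ultimately show ?thesis by metis
  qed
  then have "\<exists>r. x = (\<Sum>b\<in>?B. r b *\<^sub>R b)" for x :: "'a \<times> 'b"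
    using span_finite[OF fin] by blast
  then show "\<exists>B::('a \<times> 'b) set. finite B \<and> (\<forall>x. \<exists>r. x = (\<Sum>b\<in>B. r b *\<^sub>R b))"
    using fin by blast
qed

lemma dim_UNIV_prod:
  "dim (UNIV :: ('a::finite_dim_inner \<times> 'b::finite_dim_inner) set) = dim (UNIV :: 'a set) + dim (UNIV :: 'b set)"
proof -
  have "linear (snd :: 'a \<times> 'b \<Rightarrow> 'b)" by (simp add: linear_snd)
  moreover have "surj (snd :: 'a \<times> 'b \<Rightarrow> 'b)" by simp
  ultimately have "dim (UNIV :: ('a \<times> 'b) set) = dim {x::'a \<times> 'b. snd x = 0} + dim (UNIV :: 'b set)"
    by (rule rank_nullity)
  moreover have "{x::'a \<times> 'b. snd x = 0} = (\<lambda>a. (a, 0)) ` UNIV" by auto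
  moreover have "linear (\<lambda>a. (a, 0::'b))"
    by (rule linearI) auto
  ultimately show ?thesis
    using fin_dim_pair.dim_image_eq[of "\<lambda>a::'a. (a, 0::'b)" UNIV] by (simp add: inj_on_def)
qed

section \<open>Complex structures\<close>

definition complex_scale :: "('a::real_vector \<Rightarrow> 'a) \<Rightarrow> complex \<Rightarrow> 'a \<Rightarrow> 'a" where
  "complex_scale I z x = Re z *\<^sub>R x + Im z *\<^sub>R I x"

lemma linear_complex_scale:
  assumes "linear f" and "\<And>u. f (I u) = J (f u)"
  shows "f (complex_scale I z u) = complex_scale J z (f u)"
  by (simp add: complex_scale_def linear_add[OF assms(1)] linear_cmul[OF assms(1)] assms(2))

text \<open>
  Take \<open>C\<close> of maximal cardinality among the subsets of \<open>K\<close> that are disjoint from their image \<open>I ` C\<close>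
  and have with it a real-independent union \<open>B\<close>. If some \<open>w \<in> K\<close> were outside the span of \<open>B\<close>, then \<open>C\<close> could be enlarged by \<open>w\<close>, because \<open>I w\<close>
  is not in the span of \<open>w\<close> and \<open>B\<close>: from \<open>I w = s w + b\<close>, applying \<open>I\<close> again gives \<open>(1 + s\<^sup>2) w \<in> span B\<close>.
  So \<open>B\<close> is a real basis of \<open>K\<close>, which contains two vectors for each one of \<open>C\<close>.
\<close>

lemma exists_complex_basis:
  fixes I :: "'a::finite_dim_inner \<Rightarrow> 'a"
  assumes lin: "linear I" and II: "\<And>x. I (I x) = - x"
    and K: "subspace K" and IK: "\<And>x. x \<in> K \<Longrightarrow> I x \<in> K"
  shows "\<exists>r w. dim K = 2 * r \<and> (\<forall>i<r. w i \<in> K) \<and>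
    (\<forall>x\<in>K. \<exists>z. x = (\<Sum>i<r. complex_scale I (z i) (w i))) \<and>
    (\<forall>z. (\<Sum>i<r. complex_scale I (z i) (w i)) = 0 \<longrightarrow> (\<forall>i<r. z i = 0))"
proof -
  define good where "good C \<longleftrightarrow> C \<subseteq> K \<and> C \<inter> I ` C = {} \<and> independent (C \<union> I ` C)" for C
  have inj: "inj I" using II by (metis injI neg_equal_iff_equal)
  have good_fin: "finite C" if "good C" for C
    using that fin_dim.finiteI_independent[of "C \<union> I ` C"] by (simp add: good_def)
  have "card C \<le> dim K" if "good C" for C
  proof -
    have "card C \<le> dim (C \<union> I ` C)"
      using that good_fin[OF that] dim_eq_card_independent[of "C \<union> I ` C"]
      by (simp add: good_def card_mono)
    also have "\<dots> \<le> dim K" using that IK by (intro fin_dim.dim_subset) (auto simp: good_def)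
    finally show ?thesis .
  qed
  moreover have "good {}" by (simp add: good_def independent_empty)
  ultimately obtain C where C: "good C" and max: "\<And>D. good D \<Longrightarrow> card D \<le> card C"
    using ex_has_greatest_nat[of good "{}" card "Suc (dim K)"] by (auto simp: less_Suc_eq_le)
  have fin: "finite C" using good_fin[OF C] .
  define B where "B = C \<union> I ` C"
  have IB: "I x \<in> span B" if "x \<in> span B" for x
  proof -
    have "I b \<in> span B" if "b \<in> B" for b
      using that by (auto simp: B_def II span_neg span_base)
    then have "I ` B \<subseteq> span B" by blast
    then have "span (I ` B) \<subseteq> span B" by (simp add: span_minimal)
    then show ?thesis using that by (auto simp: linear_span_image[OF lin])
  qed
  have BK: "B \<subseteq> K" using C IK by (auto simp: good_def B_def)
  have "K \<subseteq> span B"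
  proof (rule ccontr)
    assume "\<not> K \<subseteq> span B"
    then obtain w where w: "w \<in> K" "w \<notin> span B" by blast
    have Iw: "I w \<notin> span (insert w B)"
    proof
      assume "I w \<in> span (insert w B)"
      then obtain s where s: "I w - s *\<^sub>R w \<in> span B" by (auto simp: span_insert)
      have "I (I w - s *\<^sub>R w) + s *\<^sub>R (I w - s *\<^sub>R w) \<in> span B"
        by (intro span_add span_scale IB s)
      also have "I (I w - s *\<^sub>R w) + s *\<^sub>R (I w - s *\<^sub>R w) = - (1 + s * s) *\<^sub>R w"
        by (simp add: linear_diff[OF lin] linear_cmul[OF lin] II algebra_simps)
      finally have "inverse (- (1 + s * s)) *\<^sub>R (- (1 + s * s) *\<^sub>R w) \<in> span B"
        by (rule span_scale)
      moreover have "- (1 + s * s) \<noteq> 0" using zero_le_square[of s] by linarith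
      then have "inverse (- (1 + s * s)) *\<^sub>R (- (1 + s * s) *\<^sub>R w) = w"
        unfolding scaleR_scaleR by (subst left_inverse) simp_all
      ultimately show False using w(2) by simp
    qed
    have ind: "independent (insert (I w) (insert w B))"
      using C w(2) Iw by (intro independent_insertI) (auto simp: good_def B_def)
    have eq: "insert w C \<union> I ` insert w C = insert (I w) (insert w B)" by (auto simp: B_def)
    have "w \<notin> B" "I w \<notin> insert w B" using w(2) Iw span_base by blast+
    then have "insert w C \<inter> I ` insert w C = {}"
      using C by (auto simp: good_def B_def)
    then have "good (insert w C)"
      using C w(1) ind unfolding good_def eq by blast
    moreover have "card (insert w C) = Suc (card C)"
      using \<open>w \<notin> B\<close> fin by (auto simp: B_def)
    ultimately show False using max[of "insert w C"] by simp
  qed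
  have disj: "C \<inter> I ` C = {}" and ind: "independent B" using C by (auto simp: good_def B_def)
  have dimK: "dim K = 2 * card C"
  proof -
    have "dim K = card B"
      using basis_card_eq_dim[OF BK \<open>K \<subseteq> span B\<close> ind] by simp
    also have "\<dots> = 2 * card C"
      unfolding B_def using fin disj inj by (simp add: card_Un_disjoint card_image inj_on_subset)
    finally show ?thesis .
  qed
  obtain w where w: "bij_betw w {..<card C} C"
    using ex_bij_betw_nat_finite[OF fin] by (auto simp: atLeast0LessThan)
  have sum_w: "(\<Sum>i<card C. f (w i)) = (\<Sum>c\<in>C. f c)" for f :: "'a \<Rightarrow> 'a"
    by (rule sum.reindex_bij_betw[OF w])
  have sum_B: "(\<Sum>c\<in>C. complex_scale I (Complex (u c) (u (I c))) c) = (\<Sum>b\<in>B. u b *\<^sub>R b)" for u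
    unfolding B_def using fin disj inj
    by (simp add: sum.union_disjoint sum.reindex[OF inj_on_subset[OF inj]] complex_scale_def sum.distrib)
  have "\<exists>z. x = (\<Sum>i<card C. complex_scale I (z i) (w i))" if x: "x \<in> K" for x
  proof -
    obtain u where u: "x = (\<Sum>b\<in>B. u b *\<^sub>R b)"
      using x \<open>K \<subseteq> span B\<close> span_finite[of B] fin by (auto simp: B_def)
    show ?thesis
      by (rule exI[of _ "\<lambda>i. Complex (u (w i)) (u (I (w i)))"])
        (simp add: sum_w[of "\<lambda>c. complex_scale I (Complex (u c) (u (I c))) c"] sum_B u)
  qed
  moreover have "\<forall>i<card C. z i = 0" if z: "(\<Sum>i<card C. complex_scale I (z i) (w i)) = 0" for z
  proof (intro allI impI)
    fix i assume i: "i < card C"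
    define v where "v = inv_into {..<card C} w"
    have v: "v (w j) = j" if "j < card C" for j
      using w that by (auto simp: v_def bij_betw_def)
    \<comment> \<open>The real coefficients with respect to \<open>B\<close> are the real parts of \<open>z\<close> on \<open>C\<close> and the imaginary
      parts on \<open>I ` C\<close>.\<close>
    define u where "u b = (if b \<in> C then Re (z (v b)) else Im (z (v (inv I b))))" for b
    have wC: "w j \<in> C" if "j < card C" for j using w that by (auto simp: bij_betw_def)
    have zu: "z j = Complex (u (w j)) (u (I (w j)))" if "j < card C" for j
      using that wC[OF that] disj inj by (auto simp: u_def v complex_eq_iff)
    have "0 = (\<Sum>i<card C. complex_scale I (Complex (u (w i)) (u (I (w i)))) (w i))"
      using z zu by simp
    also have "\<dots> = (\<Sum>b\<in>B. u b *\<^sub>R b)"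
      by (simp add: sum_w[of "\<lambda>c. complex_scale I (Complex (u c) (u (I c))) c"] sum_B)
    finally have "\<forall>b\<in>B. u b = 0"
      using independentD[OF ind _ subset_refl, of u] fin by (simp add: B_def)
    then show "z i = 0"
      using zu[OF i] wC[OF i] by (auto simp: B_def complex_eq_iff)
  qed
  moreover have "\<forall>i<card C. w i \<in> K" using w C by (auto simp: bij_betw_def good_def)
  ultimately show ?thesis using dimK by blast
qed

text \<open>
  Any real-linear right inverse \<open>h\<close> becomes complex linear by averaging it with \<open>- I \<circ> h \<circ> J\<close>, which is
  a right inverse as well.
\<close>

lemma complex_linear_right_inverse:
  fixes f :: "'a::real_vector \<Rightarrow> 'b::real_vector"
  assumes f: "linear f" "surj f" and I: "linear I" "\<And>u. I (I u) = - u"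
    and J: "linear J" "\<And>y. J (J y) = - y" and fI: "\<And>u. f (I u) = J (f u)"
  obtains g where "linear g" "\<And>y. f (g y) = y" "\<And>y. g (J y) = I (g y)"
proof -
  obtain h where h: "linear h" "f \<circ> h = id"
    using linear_surjective_right_inverse[OF f] by blast
  have fh: "f (h y) = y" for y using h(2) by (metis comp_apply id_apply)
  define g where "g y = (1/2) *\<^sub>R (h y - I (h (J y)))" for y
  show ?thesis
  proof
    show "linear g"
      by (rule linearI) (simp_all add: g_def linear_add[OF h(1)] linear_add[OF I(1)] linear_add[OF J(1)]
          linear_cmul[OF h(1)] linear_cmul[OF I(1)] linear_cmul[OF J(1)] algebra_simps)
    show "f (g y) = y" for y
      by (simp add: g_def linear_cmul[OF f(1)] linear_diff[OF f(1)] fI fh J scaleR_2[symmetric])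
    show "g (J y) = I (g y)" for y
      by (simp add: g_def linear_cmul[OF I(1)] linear_diff[OF I(1)] I(2) J(2) linear_neg[OF h(1)]
          linear_neg[OF I(1)] add.commute)
  qed
qed

lemma linear_imult: "linear (imult :: 'a::complex_model \<Rightarrow> 'a)"
  by (rule linearI) (simp_all add: imult_add imult_scaleR)

lemma even_dim_complex_model: "even (dim (UNIV :: 'a::complex_model set))"
  using exists_complex_basis[OF linear_imult imult_imult, of "UNIV :: 'a set"] by auto

text \<open>
  The map \<open>(a, b) \<mapsto> A a - J (A b)\<close> is injective because the range of \<open>A\<close> is totally real, hence
  surjective by dimension.
\<close>

lemma totally_real_sum:
  fixes A :: "'a::finite_dim_inner \<Rightarrow> 'b::complex_model"
  assumes A: "linear A" "inj A" and real: "\<And>a b. A a = imult (A b) \<Longrightarrow> A a = 0"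
    and dim: "2 * dim (UNIV :: 'a set) = dim (UNIV :: 'b set)"
  obtains a b where "y = A a - imult (A b)"
proof -
  define T where "T = (\<lambda>(a, b). A a - imult (A b))"
  have T: "linear T"
    by (rule linearI)
      (auto simp: T_def linear_add[OF A(1)] linear_cmul[OF A(1)] imult_add imult_scaleR scaleR_diff_right)
  have "inj T"
  proof (rule linear_inj_on_iff_eq_0[OF T subspace_UNIV, THEN iffD2], clarify)
    fix a b assume "T (a, b) = 0"
    then have *: "A a = imult (A b)" by (simp add: T_def)
    then have "A a = 0" by (rule real)
    moreover from this * have "imult (imult (A b)) = 0" by (simp add: linear_0[OF linear_imult])
    then have "A b = 0" by (simp add: imult_imult)
    ultimately show "(a, b) = 0"
      using A by (simp add: linear_injective_0 zero_prod_def)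
  qed
  moreover have "dim (UNIV :: 'b set) = dim (UNIV :: ('a \<times> 'a) set)"
    using dim by (simp add: dim_UNIV_prod)
  ultimately have "surj T" by (rule fin_dim_pair.linear_injective_imp_surjective[OF T])
  then obtain p where "y = T p" by blast
  then show ?thesis using that by (cases p) (simp add: T_def)
qed

text \<open>
  Multiplication by \<open>\<i>\<close> when the pair \<open>(a, b)\<close> stands for \<open>a + \<i> b\<close>.
\<close>

definition mult_i :: "'a::real_vector \<times> 'a \<Rightarrow> 'a \<times> 'a" where
  "mult_i w = (- snd w, fst w)"

lemma linear_mult_i: "linear mult_i"
  by (rule linearI) (simp_all add: mult_i_def)

lemma mult_i_mult_i: "mult_i (mult_i w) = - w"
  by (simp add: mult_i_def prod_eq_iff)

text \<open>
  For a linear \<open>f\<close>, this vanishes at \<open>a + \<i> b\<close> exactly if the complexification of \<open>f\<close> takes that vector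
  into the \<open>\<i>\<close>-eigenspace. It is, up to a factor, the component of \<open>f\<^sub>\<complex>\<close> in the \<open>- \<i>\<close>-eigenspace, which is
  identified with the target by taking real parts; hence it intertwines \<open>\<i>\<close> with \<open>- J\<close>.
\<close>

definition antiholomorphic_part :: "('a \<Rightarrow> 'b::complex_model) \<Rightarrow> 'a \<times> 'a \<Rightarrow> 'b" where
  "antiholomorphic_part f w = f (fst w) - imult (f (snd w))"

lemma linear_antiholomorphic_part:
  assumes f: "linear f"
  shows "linear (antiholomorphic_part f)"
  by (rule linearI) (simp_all add: antiholomorphic_part_def linear_add[OF f] linear_cmul[OF f]
      imult_add imult_scaleR scaleR_diff_right)

lemma antiholomorphic_part_mult_i:
  assumes f: "linear f"
  shows "antiholomorphic_part f (mult_i w) = - imult (antiholomorphic_part f w)"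
  by (simp add: antiholomorphic_part_def mult_i_def linear_neg[OF f] linear_diff[OF linear_imult] imult_imult)

section \<open>Calculus of smooth maps\<close>

lemma frechet_derivative_eq:
  "(f has_derivative f') (at x) \<Longrightarrow> frechet_derivative f (at x) = f'"
  by (metis frechet_derivative_at)

lemma Ck_on_cong:
  assumes "open S" and "\<And>x. x \<in> S \<Longrightarrow> f x = g x" and "Ck_on n S f"
  shows "Ck_on n S g"
  using assms(2,3)
proof (induction n arbitrary: f g)
  case 0
  then show ?case by (auto cong: continuous_on_cong)
next
  case (Suc n)
  have der: "(g has_derivative frechet_derivative f (at x)) (at x)" if "x \<in> S" for x
  proof (rule has_derivative_transform_within_open[OF _ assms(1) that])
    show "(f has_derivative frechet_derivative f (at x)) (at x)"
      using Suc.prems(2) that by (simp add: frechet_derivative_works)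
  qed (simp add: Suc.prems(1))
  have "Ck_on n S (\<lambda>x. frechet_derivative g (at x) v)" for v
    by (rule Suc.IH[of "\<lambda>x. frechet_derivative f (at x) v"])
      (use Suc.prems(2) frechet_derivative_eq[OF der] in auto)
  then show ?case
    using der by (auto simp: differentiable_def)
qed

text \<open>
  Lets any explicit derivative take the place of the one picked by \<^const>\<open>frechet_derivative\<close>; the closure
  properties of \<^const>\<open>Ck_on\<close> below are inductions through this rule.
\<close>

lemma Ck_on_SucI:
  assumes "open S" and "\<And>x. x \<in> S \<Longrightarrow> (f has_derivative f' x) (at x)"
    and "\<And>v. Ck_on n S (\<lambda>x. f' x v)"
  shows "Ck_on (Suc n) S f"
  using assms(2) Ck_on_cong[OF assms(1) _ assms(3)] frechet_derivative_eq[OF assms(2)]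
  by (auto simp: differentiable_def)

lemma Ck_on_SucD:
  assumes "Ck_on (Suc n) S f"
  shows "\<And>x. x \<in> S \<Longrightarrow> (f has_derivative frechet_derivative f (at x)) (at x)"
    and "\<And>v. Ck_on n S (\<lambda>x. frechet_derivative f (at x) v)"
  using assms by (auto simp: frechet_derivative_works)

lemma Ck_on_Suc_imp: "Ck_on (Suc n) S f \<Longrightarrow> Ck_on n S f"
proof (induction n arbitrary: f)
  case 0
  then show ?case
    by (auto intro!: continuous_at_imp_continuous_on differentiable_imp_continuous_within)
qed auto

lemma Ck_on_subset: "Ck_on n S f \<Longrightarrow> T \<subseteq> S \<Longrightarrow> Ck_on n T f"
  by (induction n arbitrary: f) (auto intro: continuous_on_subset)

lemma Ck_on_locally:
  "(\<And>x. x \<in> S \<Longrightarrow> \<exists>T. open T \<and> x \<in> T \<and> Ck_on n T f) \<Longrightarrow> Ck_on n S f"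
proof (induction n arbitrary: f)
  case 0
  have "isCont f x" if "x \<in> S" for x
    using 0[OF that] by (auto simp: continuous_on_eq_continuous_at)
  then show ?case by (simp add: continuous_at_imp_continuous_on)
next
  case (Suc n)
  have "f differentiable (at x)" if "x \<in> S" for x
    using Suc.prems[OF that] by auto
  moreover have "Ck_on n S (\<lambda>x. frechet_derivative f (at x) v)" for v
    by (rule Suc.IH) (use Suc.prems in fastforce)
  ultimately show ?case by simp
qed

lemma Ck_on_const: "Ck_on n S (\<lambda>x. c)"
proof (induction n arbitrary: c)
  case (Suc n)
  then show ?case by (simp add: frechet_derivative_const)
qed simp

lemma Ck_on_linear:
  assumes "open S" and "bounded_linear l" and "Ck_on n S f"
  shows "Ck_on n S (\<lambda>x. l (f x))"
  using assms(3)
proof (induction n arbitrary: f)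
  case 0
  then show ?case by (simp add: bounded_linear.continuous_on[OF assms(2)])
next
  case (Suc n)
  show ?case
    by (rule Ck_on_SucI[OF assms(1) bounded_linear.has_derivative[OF assms(2) Ck_on_SucD(1)[OF Suc.prems]]])
      (auto intro: Suc.IH Ck_on_SucD(2)[OF Suc.prems])
qed

lemma Ck_on_add:
  assumes "open S" and "Ck_on n S f" and "Ck_on n S g"
  shows "Ck_on n S (\<lambda>x. f x + g x)"
  using assms(2,3)
proof (induction n arbitrary: f g)
  case 0
  then show ?case by (simp add: continuous_on_add)
next
  case (Suc n)
  show ?case
    by (rule Ck_on_SucI[OF assms(1) has_derivative_add[OF Ck_on_SucD(1)[OF Suc.prems(1)] Ck_on_SucD(1)[OF Suc.prems(2)]]])
      (assumption | intro Suc.IH Ck_on_SucD(2)[OF Suc.prems(1)] Ck_on_SucD(2)[OF Suc.prems(2)])+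
qed

lemma Ck_on_sum:
  assumes "open S" and "\<And>i. i \<in> I \<Longrightarrow> Ck_on n S (f i)"
  shows "Ck_on n S (\<lambda>x. \<Sum>i\<in>I. f i x)"
  using assms(2)
  by (induction I rule: infinite_finite_induct) (auto intro: Ck_on_const Ck_on_add[OF assms(1)])

lemma Ck_on_bilinear:
  assumes "open S" and bil: "bounded_bilinear m" and "Ck_on n S f" and "Ck_on n S g"
  shows "Ck_on n S (\<lambda>x. m (f x) (g x))"
  using assms(3,4)
proof (induction n arbitrary: f g)
  case 0
  then show ?case by (simp add: bounded_bilinear.continuous_on[OF bil])
next
  case (Suc n)
  show ?case
    by (rule Ck_on_SucI[OF assms(1) bounded_bilinear.FDERIV[OF bil Ck_on_SucD(1)[OF Suc.prems(1)] Ck_on_SucD(1)[OF Suc.prems(2)]]])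
      (assumption | intro Ck_on_add[OF assms(1)] Suc.IH Ck_on_SucD(2)[OF Suc.prems(1)]
        Ck_on_SucD(2)[OF Suc.prems(2)] Ck_on_Suc_imp[OF Suc.prems(1)] Ck_on_Suc_imp[OF Suc.prems(2)])+
qed

lemmas Ck_on_scaleR = Ck_on_bilinear[OF _ bounded_bilinear_scaleR]

lemma Ck_on_inner_left: "open S \<Longrightarrow> Ck_on n S f \<Longrightarrow> Ck_on n S (\<lambda>x. inner (f x) c)"
  by (rule Ck_on_linear[OF _ bounded_linear_inner_left])

text \<open>
  Expanding the argument \<open>v x\<close> in the orthonormal basis turns \<open>L x (v x)\<close> into a finite sum of products of
  scalar functions with the functions \<open>L x b\<close>.
\<close>

lemma Ck_on_apply_family:
  fixes L :: "'a::real_normed_vector \<Rightarrow> 'b::finite_dim_inner \<Rightarrow> 'c::real_normed_vector"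
  assumes "open S" and "\<And>x. x \<in> S \<Longrightarrow> linear (L x)" and "\<And>w. Ck_on n S (\<lambda>x. L x w)"
    and "Ck_on n S v"
  shows "Ck_on n S (\<lambda>x. L x (v x))"
proof (rule Ck_on_cong[OF assms(1)])
  show "Ck_on n S (\<lambda>x. \<Sum>b\<in>onb. inner (v x) b *\<^sub>R L x b)"
    by (rule Ck_on_sum[OF assms(1)])
      (rule Ck_on_scaleR[OF assms(1) Ck_on_inner_left[OF assms(1,4)] assms(3)])
  show "(\<Sum>b\<in>onb. inner (v x) b *\<^sub>R L x b) = L x (v x)" if "x \<in> S" for x
    by (rule linear_onb_expansion[OF assms(2)[OF that], symmetric])
qed

text \<open>
  The chain rule writes the derivative as the family \<open>Df (g x)\<close>, differentiable once less, applied to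
  \<open>Dg x v\<close>.
\<close>

lemma Ck_on_compose:
  fixes g :: "'a::real_normed_vector \<Rightarrow> 'b::finite_dim_inner"
    and f :: "'b \<Rightarrow> 'c::real_normed_vector"
  assumes S: "open S" and "g ` S \<subseteq> T" and "Ck_on n S g" and "Ck_on n T f"
  shows "Ck_on n S (\<lambda>x. f (g x))"
  using assms(3,4)
proof (induction n arbitrary: f)
  case 0
  then show ?case using assms(2) by (auto intro: continuous_on_compose2)
next
  case (Suc n)
  have gT: "g x \<in> T" if "x \<in> S" for x using that assms(2) by blast
  have der: "((\<lambda>x. f (g x)) has_derivative
      (\<lambda>v. frechet_derivative f (at (g x)) (frechet_derivative g (at x) v))) (at x)" if "x \<in> S" for x
    by (rule has_derivative_compose[OF Ck_on_SucD(1)[OF Suc.prems(1) that]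
          Ck_on_SucD(1)[OF Suc.prems(2) gT[OF that]]])
  show ?case
  proof (rule Ck_on_SucI[OF S der])
    show "Ck_on n S (\<lambda>x. frechet_derivative f (at (g x)) (frechet_derivative g (at x) v))" for v
    proof (rule Ck_on_apply_family[OF S])
      show "linear (frechet_derivative f (at (g x)))" if "x \<in> S" for x
        by (rule has_derivative_linear[OF Ck_on_SucD(1)[OF Suc.prems(2) gT[OF that]]])
      show "Ck_on n S (\<lambda>x. frechet_derivative f (at (g x)) w)" for w
        by (rule Suc.IH[OF Ck_on_Suc_imp[OF Suc.prems(1)] Ck_on_SucD(2)[OF Suc.prems(2)]])
    qed (rule Ck_on_SucD(2)[OF Suc.prems(1)])
  qed
qed

text \<open>
  A product rule in which the second factor need only be continuous, as its increment is multiplied by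
  a factor that tends to 0 at first order. It gives the derivative of the inverse of a family of linear
  maps without knowing beforehand that this inverse is differentiable.
\<close>

lemma has_derivative_vanishing_scaleR:
  fixes \<phi> :: "'a::real_normed_vector \<Rightarrow> real" and c :: "'a \<Rightarrow> 'b::real_normed_vector"
  assumes \<phi>: "(\<phi> has_derivative \<phi>') (at x)" "\<phi> x = 0" and c: "isCont c x"
  shows "((\<lambda>y. \<phi> y *\<^sub>R c y) has_derivative (\<lambda>h. \<phi>' h *\<^sub>R c x)) (at x)"
proof -
  obtain K where K: "\<And>h. norm (\<phi>' h) \<le> norm h * K" "K > 0"
    using bounded_linear.pos_bounded[OF has_derivative_bounded_linear[OF \<phi>(1)]] by blast
  \<comment> \<open>The error made by freezing \<open>c\<close> at \<open>x\<close> vanishes faster than linearly.\<close>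
  have "((\<lambda>y. \<phi> y *\<^sub>R (c y - c x)) has_derivative (\<lambda>h. 0)) (at x)"
    unfolding has_derivative_at_alt
  proof (intro conjI allI impI)
    fix e :: real assume e: "0 < e"
    have "\<forall>e>0. \<exists>d>0. \<forall>y. norm (y - x) < d \<longrightarrow>
        norm (\<phi> y - \<phi> x - \<phi>' (y - x)) \<le> e * norm (y - x)"
      by (rule conjunct2[OF has_derivative_at_alt[THEN iffD1, OF \<phi>(1)]])
    then have "\<exists>d>0. \<forall>y. norm (y - x) < d \<longrightarrow>
        norm (\<phi> y - \<phi> x - \<phi>' (y - x)) \<le> 1 * norm (y - x)"
      by (rule allE) (erule mp, rule zero_less_one)
    then obtain d1 where d1: "d1 > 0"
      "\<And>y. norm (y - x) < d1 \<Longrightarrow> norm (\<phi> y - \<phi> x - \<phi>' (y - x)) \<le> 1 * norm (y - x)"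
      by blast
    have "e / (1 + K) > 0" using e K(2) by simp
    note cont = c[unfolded continuous_at_eps_delta dist_norm, rule_format, OF this]
    obtain d2 where d2: "d2 > 0" "\<And>y. norm (y - x) < d2 \<Longrightarrow> norm (c y - c x) < e / (1 + K)"
      using cont by blast
    show "\<exists>d>0. \<forall>y. norm (y - x) < d \<longrightarrow>
        norm (\<phi> y *\<^sub>R (c y - c x) - \<phi> x *\<^sub>R (c x - c x) - 0) \<le> e * norm (y - x)"
    proof (intro exI[of _ "min d1 d2"] conjI allI impI)
      fix y assume y: "norm (y - x) < min d1 d2"
      have "\<bar>\<phi> y\<bar> \<le> norm (y - x) * (1 + K)"
        using d1(2)[of y] K(1)[of "y - x"] y \<phi>(2) by (simp add: algebra_simps)
      moreover have "norm (c y - c x) \<le> e / (1 + K)" using d2(2)[of y] y by simp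
      ultimately have "\<bar>\<phi> y\<bar> * norm (c y - c x) \<le> (norm (y - x) * (1 + K)) * (e / (1 + K))"
        using K(2) by (intro mult_mono) auto
      also have "\<dots> = e * norm (y - x)" using K(2) by simp
      finally show "norm (\<phi> y *\<^sub>R (c y - c x) - \<phi> x *\<^sub>R (c x - c x) - 0) \<le> e * norm (y - x)"
        by simp
    qed (use d1 d2 in simp)
  qed simp
  from has_derivative_add[OF has_derivative_scaleR_left[OF \<phi>(1), of "c x"] this]
  show ?thesis by (simp add: scaleR_diff_right)
qed

text \<open>
  Put \<open>w = G x y\<close>. Then \<open>G x' y = w - G x' (M x' w - y)\<close>, and \<open>M x' w - y\<close> vanishes at \<open>x' = x\<close>. The lower
  bound on \<open>M\<close> bounds \<open>G\<close>, so this formula gives first continuity of \<open>G\<close> in \<open>x\<close> and then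
  differentiability. The resulting derivative \<open>- G x (DM x (G x y))\<close> is built from \<open>M\<close> and \<open>G\<close> only, which
  makes the induction on the order work.
\<close>

lemma Ck_on_inverse_family:
  fixes M :: "'a::real_normed_vector \<Rightarrow> 'b::finite_dim_inner \<Rightarrow> 'b"
  assumes S: "open S" and lin: "\<And>x. x \<in> S \<Longrightarrow> linear (M x)"
    and M: "\<And>n w. Ck_on n S (\<lambda>x. M x w)"
    and bound: "\<And>x w. x \<in> S \<Longrightarrow> norm (M x w) \<ge> norm w / 2"
    and MG: "\<And>x y. x \<in> S \<Longrightarrow> M x (G x y) = y"
  shows "Ck_on n S (\<lambda>x. G x y)"
proof -
  have inj: "u = w" if "x \<in> S" "M x u = M x w" for x u w
    using bound[OF that(1), of "u - w"] that(2) by (simp add: linear_diff[OF lin[OF that(1)]])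
  have GM: "G x (M x w) = w" if "x \<in> S" for x w
    using inj[OF that, of "G x (M x w)" w] MG[OF that] by simp
  have linG: "linear (G x)" if x: "x \<in> S" for x
    by (rule linearI; rule inj[OF x])
      (simp_all add: MG[OF x] linear_add[OF lin[OF x]] linear_cmul[OF lin[OF x]])
  have boundG: "norm (G x y) \<le> 2 * norm y" if "x \<in> S" for x y
    using bound[OF that, of "G x y"] MG[OF that, of y] by simp
  have key: "G x' y = G x y - G x' (M x' (G x y) - y)" if "x \<in> S" "x' \<in> S" for x x' y
    by (simp add: linear_diff[OF linG[OF that(2)]] GM that)
  have cont: "isCont (\<lambda>x. G x y) x" if x: "x \<in> S" for x y
  proof -
    let ?w = "G x y"
    have "isCont (\<lambda>x. M x ?w) x"
      using M[of 0 ?w] S x by (simp add: continuous_on_eq_continuous_at)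
    then have "((\<lambda>x'. 2 * norm (M x' ?w - y)) \<longlongrightarrow> 2 * norm (M x ?w - y)) (at x)"
      by (intro tendsto_intros) (simp add: isCont_def)
    then have lim: "((\<lambda>x'. 2 * norm (M x' ?w - y)) \<longlongrightarrow> 0) (at x)" by (simp add: MG x)
    have "\<forall>\<^sub>F x' in at x. x' \<in> S"
      using S x by (metis eventually_at_topological)
    then have "\<forall>\<^sub>F x' in at x. norm (G x' y - ?w) \<le> 2 * norm (M x' ?w - y)"
    proof (rule eventually_mono)
      fix x' assume x': "x' \<in> S"
      have "norm (G x' y - ?w) = norm (G x' (M x' ?w - y))"
        by (subst key[OF x x']) simp
      then show "norm (G x' y - ?w) \<le> 2 * norm (M x' ?w - y)" using boundG[OF x'] by simp
    qed
    from Lim_null_comparison[OF this lim] show ?thesis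
      by (simp add: isCont_def LIM_zero_iff)
  qed
  let ?D = "\<lambda>x y h. - (\<Sum>b\<in>onb. (\<Sum>c\<in>onb. inner (G x y) c *
      inner (frechet_derivative (\<lambda>x. M x c) (at x) h) b) *\<^sub>R G x b)"
  have der: "((\<lambda>x. G x y) has_derivative ?D x y) (at x)" if x: "x \<in> S" for x y
  proof -
    let ?w = "G x y"
    have Mexp: "inner (M x' ?w - y) b = (\<Sum>c\<in>onb. inner ?w c * inner (M x' c) b) - inner y b"
      if "x' \<in> S" for x' b
      by (subst linear_onb_expansion[OF lin[OF that], of ?w])
        (simp add: inner_diff_left inner_sum_left)
    have derM: "((\<lambda>x. M x c) has_derivative frechet_derivative (\<lambda>x. M x c) (at x)) (at x)" for c
      by (rule Ck_on_SucD(1)[OF M x])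
    have "((\<lambda>x'. ((\<Sum>c\<in>onb. inner ?w c * inner (M x' c) b) - inner y b) *\<^sub>R G x' b) has_derivative
        (\<lambda>h. (\<Sum>c\<in>onb. inner ?w c * inner (frechet_derivative (\<lambda>x. M x c) (at x) h) b) *\<^sub>R G x b)) (at x)"
      for b
    proof (rule has_derivative_vanishing_scaleR[OF _ _ cont[OF x]])
      show "((\<lambda>x'. (\<Sum>c\<in>onb. inner ?w c * inner (M x' c) b) - inner y b) has_derivative
          (\<lambda>h. \<Sum>c\<in>onb. inner ?w c * inner (frechet_derivative (\<lambda>x. M x c) (at x) h) b)) (at x)"
        by (auto intro!: derivative_eq_intros derM)
      show "(\<Sum>c\<in>onb. inner ?w c * inner (M x c) b) - inner y b = 0"
        using Mexp[OF x, of b] by (simp add: MG[OF x])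
    qed
    then have "((\<lambda>x'. ?w - (\<Sum>b\<in>onb. ((\<Sum>c\<in>onb. inner ?w c * inner (M x' c) b) - inner y b) *\<^sub>R G x' b))
        has_derivative (\<lambda>h. 0 - (\<Sum>b\<in>onb. (\<Sum>c\<in>onb. inner ?w c *
      inner (frechet_derivative (\<lambda>x. M x c) (at x) h) b) *\<^sub>R G x b))) (at x)"
      by (intro has_derivative_diff has_derivative_const has_derivative_sum)
    then have "((\<lambda>x'. ?w - (\<Sum>b\<in>onb. ((\<Sum>c\<in>onb. inner ?w c * inner (M x' c) b) - inner y b) *\<^sub>R G x' b))
        has_derivative ?D x y) (at x)"
      by simp
    then show ?thesis
    proof (rule has_derivative_transform_within_open[OF _ S x])
      fix x' assume x': "x' \<in> S"
      show "?w - (\<Sum>b\<in>onb. ((\<Sum>c\<in>onb. inner ?w c * inner (M x' c) b) - inner y b) *\<^sub>R G x' b) = G x' y"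
        unfolding key[OF x x', of y] Mexp[OF x', symmetric]
          linear_onb_expansion[OF linG[OF x'], of "M x' ?w - y"] ..
    qed
  qed
  show ?thesis
  proof (induction n arbitrary: y)
    case 0
    then show ?case using cont by (simp add: continuous_at_imp_continuous_on)
  next
    case (Suc n)
    have "Ck_on n S (\<lambda>x. ?D x y h)" for h
      by (rule Ck_on_linear[OF S bounded_linear_minus[OF bounded_linear_ident]],
          rule Ck_on_sum[OF S], rule Ck_on_scaleR[OF S _ Suc.IH], rule Ck_on_sum[OF S],
          rule Ck_on_bilinear[OF S bounded_bilinear_mult Ck_on_inner_left[OF S Suc.IH]
            Ck_on_inner_left[OF S Ck_on_SucD(2)[OF M]]])
    then show ?case by - (rule Ck_on_SucI[where f' = "\<lambda>x. ?D x y", OF S der])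
  qed
qed

lemma smooth_on_has_derivative:
  "smooth_on S f \<Longrightarrow> x \<in> S \<Longrightarrow> (f has_derivative frechet_derivative f (at x)) (at x)"
  unfolding smooth_on_def by (metis Ck_on_SucD(1))

lemma smooth_on_frechet_derivative:
  "smooth_on S f \<Longrightarrow> smooth_on S (\<lambda>x. frechet_derivative f (at x) v)"
  unfolding smooth_on_def by (metis Ck_on_SucD(2))

lemma smooth_on_linear_derivative:
  "smooth_on S f \<Longrightarrow> x \<in> S \<Longrightarrow> linear (frechet_derivative f (at x))"
  by (rule has_derivative_linear[OF smooth_on_has_derivative])

lemma smooth_on_imp_continuous_on: "smooth_on S f \<Longrightarrow> continuous_on S f"
  unfolding smooth_on_def by (metis Ck_on.simps(1))

lemma smooth_on_cong:
  "open S \<Longrightarrow> (\<And>x. x \<in> S \<Longrightarrow> f x = g x) \<Longrightarrow> smooth_on S f \<Longrightarrow> smooth_on S g"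
  unfolding smooth_on_def using Ck_on_cong[of S f g] by blast

lemma smooth_on_subset: "smooth_on S f \<Longrightarrow> T \<subseteq> S \<Longrightarrow> smooth_on T f"
  unfolding smooth_on_def using Ck_on_subset by blast

lemma smooth_on_locally:
  "(\<And>x. x \<in> S \<Longrightarrow> \<exists>T. open T \<and> x \<in> T \<and> smooth_on T f) \<Longrightarrow> smooth_on S f"
  unfolding smooth_on_def by (intro allI Ck_on_locally) blast

lemma smooth_on_const: "smooth_on S (\<lambda>x. c)"
  unfolding smooth_on_def by (simp add: Ck_on_const)

lemma smooth_on_linear:
  "open S \<Longrightarrow> bounded_linear l \<Longrightarrow> smooth_on S f \<Longrightarrow> smooth_on S (\<lambda>x. l (f x))"
  unfolding smooth_on_def by (simp add: Ck_on_linear)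

lemma smooth_on_add:
  "open S \<Longrightarrow> smooth_on S f \<Longrightarrow> smooth_on S g \<Longrightarrow> smooth_on S (\<lambda>x. f x + g x)"
  unfolding smooth_on_def by (simp add: Ck_on_add)

lemma smooth_on_diff:
  "open S \<Longrightarrow> smooth_on S f \<Longrightarrow> smooth_on S g \<Longrightarrow> smooth_on S (\<lambda>x. f x - g x)"
  using smooth_on_add[of S f "\<lambda>x. - g x"]
    smooth_on_linear[of S uminus g, OF _ bounded_linear_minus[OF bounded_linear_ident]] by simp

lemma smooth_on_apply_family:
  fixes L :: "'a::real_normed_vector \<Rightarrow> 'b::finite_dim_inner \<Rightarrow> 'c::real_normed_vector"
  shows "open S \<Longrightarrow> (\<And>x. x \<in> S \<Longrightarrow> linear (L x)) \<Longrightarrow> (\<And>w. smooth_on S (\<lambda>x. L x w)) \<Longrightarrow>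
    smooth_on S v \<Longrightarrow> smooth_on S (\<lambda>x. L x (v x))"
  unfolding smooth_on_def by (simp add: Ck_on_apply_family)

lemma smooth_on_derivative_apply:
  fixes f :: "'a::finite_dim_inner \<Rightarrow> 'b::real_normed_vector"
  assumes S: "open S" and f: "smooth_on S f" and v: "smooth_on S v"
  shows "smooth_on S (\<lambda>x. frechet_derivative f (at x) (v x))"
  by (rule smooth_on_apply_family[where L = "\<lambda>x. frechet_derivative f (at x)",
        OF S smooth_on_linear_derivative[OF f] smooth_on_frechet_derivative[OF f] v])

lemma smooth_on_compose:
  fixes g :: "'a::real_normed_vector \<Rightarrow> 'b::finite_dim_inner"
    and f :: "'b \<Rightarrow> 'c::real_normed_vector"
  shows "open S \<Longrightarrow> smooth_on S g \<Longrightarrow> smooth_on T f \<Longrightarrow> g ` S \<subseteq> T \<Longrightarrow> smooth_on S (\<lambda>x. f (g x))"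
  unfolding smooth_on_def by (simp add: Ck_on_compose)

section \<open>Second derivatives and brackets of vector fields\<close>

lemma has_derivative_along_line:
  fixes f :: "'a::real_normed_vector \<Rightarrow> real"
  assumes "(f has_derivative f') (at (p + s *\<^sub>R u))"
  shows "((\<lambda>s. f (p + s *\<^sub>R u)) has_real_derivative f' u) (at s)"
proof -
  have "((\<lambda>s. p + s *\<^sub>R u) has_derivative (\<lambda>h. h *\<^sub>R u)) (at s)"
    by (auto intro!: derivative_eq_intros)
  from has_derivative_compose[OF this assms]
  have "((\<lambda>s. f (p + s *\<^sub>R u)) has_derivative (\<lambda>h. f' (h *\<^sub>R u))) (at s)" .
  moreover have "(\<lambda>h. f' (h *\<^sub>R u)) = (*) (f' u)"
    using linear_cmul[OF has_derivative_linear[OF assms]] by (auto simp: mult.commute)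
  ultimately show ?thesis by (simp add: has_field_derivative_def)
qed

text \<open>
  Two applications of the mean value theorem: to \<open>s \<mapsto> f (x + s u + h v) - f (x + s u)\<close>, and then to the
  derivative in direction \<open>u\<close> along \<open>v\<close>.
\<close>

lemma mixed_difference_mean_value:
  fixes f :: "'a::real_normed_vector \<Rightarrow> real"
  assumes f: "\<And>y. y \<in> ball x r \<Longrightarrow> (f has_derivative f' y) (at y)"
    and fu: "\<And>y. y \<in> ball x r \<Longrightarrow> ((\<lambda>y. f' y u) has_derivative fu y) (at y)"
    and h: "h > 0" "h * (norm u + norm v) < r"
  obtains y where "norm (y - x) \<le> h * (norm u + norm v)"
    "f (x + h *\<^sub>R u + h *\<^sub>R v) - f (x + h *\<^sub>R u) - f (x + h *\<^sub>R v) + f x = h * h * fu y v"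
proof -
  have close: "norm (s *\<^sub>R u + t *\<^sub>R v) \<le> h * (norm u + norm v)"
    if "0 \<le> s" "s \<le> h" "0 \<le> t" "t \<le> h" for s t
  proof -
    have "norm (s *\<^sub>R u + t *\<^sub>R v) \<le> s * norm u + t * norm v"
      using that norm_triangle_ineq[of "s *\<^sub>R u" "t *\<^sub>R v"] by simp
    also have "\<dots> \<le> h * norm u + h * norm v"
      using that by (intro add_mono mult_right_mono) auto
    finally show ?thesis by (simp add: algebra_simps)
  qed
  have near: "x + s *\<^sub>R u + t *\<^sub>R v \<in> ball x r" if "0 \<le> s" "s \<le> h" "0 \<le> t" "t \<le> h" for s t
    using close[OF that] h(2) by (simp add: dist_norm norm_minus_commute algebra_simps)
  define \<phi> where "\<phi> s = f ((x + h *\<^sub>R v) + s *\<^sub>R u) - f (x + s *\<^sub>R u)" for s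
  have "\<exists>s>0. s < h \<and> \<phi> h - \<phi> 0 = (h - 0) * (f' (x + h *\<^sub>R v + s *\<^sub>R u) u - f' (x + s *\<^sub>R u) u)"
  proof (rule MVT2[OF h(1)])
    fix s assume s: "0 \<le> s" "s \<le> h"
    show "(\<phi> has_real_derivative f' (x + h *\<^sub>R v + s *\<^sub>R u) u - f' (x + s *\<^sub>R u) u) (at s)"
      unfolding \<phi>_def
      using near[OF s, of h] near[OF s, of 0] h(1)
      by (intro DERIV_diff has_derivative_along_line f) (simp_all add: algebra_simps)
  qed
  then obtain s where s: "0 < s" "s < h"
    "\<phi> h - \<phi> 0 = h * (f' (x + h *\<^sub>R v + s *\<^sub>R u) u - f' (x + s *\<^sub>R u) u)" by auto
  have "\<exists>t>0. t < h \<and> f' ((x + s *\<^sub>R u) + h *\<^sub>R v) u - f' ((x + s *\<^sub>R u) + 0 *\<^sub>R v) u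
      = (h - 0) * fu (x + s *\<^sub>R u + t *\<^sub>R v) v"
  proof (rule MVT2[OF h(1)])
    fix t assume "0 \<le> t" "t \<le> h"
    then show "((\<lambda>t. f' ((x + s *\<^sub>R u) + t *\<^sub>R v) u) has_real_derivative fu (x + s *\<^sub>R u + t *\<^sub>R v) v) (at t)"
      using near[of s t] s by (intro has_derivative_along_line fu) simp_all
  qed
  then obtain t where t: "0 < t" "t < h"
    "f' ((x + s *\<^sub>R u) + h *\<^sub>R v) u - f' (x + s *\<^sub>R u) u = h * fu (x + s *\<^sub>R u + t *\<^sub>R v) v" by auto
  show ?thesis
  proof (rule that)
    show "norm ((x + s *\<^sub>R u + t *\<^sub>R v) - x) \<le> h * (norm u + norm v)"
      using close[of s t] s t by (simp add: algebra_simps)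
    show "f (x + h *\<^sub>R u + h *\<^sub>R v) - f (x + h *\<^sub>R u) - f (x + h *\<^sub>R v) + f x = h * h * fu (x + s *\<^sub>R u + t *\<^sub>R v) v"
      using s(3) t(3) by (simp add: \<phi>_def ac_simps)
  qed
qed

text \<open>
  The second difference quotient is symmetric in \<open>u\<close> and \<open>v\<close>, so for each small \<open>h\<close> the two mixed
  derivatives agree at some pair of points close to \<open>x\<close>; continuity takes this to \<open>x\<close>.
\<close>

lemma mixed_second_derivatives_eq:
  fixes f :: "'a::real_normed_vector \<Rightarrow> real"
  assumes S: "open S" "x \<in> S"
    and f: "\<And>y. y \<in> S \<Longrightarrow> (f has_derivative f' y) (at y)"
    and fu: "\<And>y. y \<in> S \<Longrightarrow> ((\<lambda>y. f' y u) has_derivative fu y) (at y)"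
    and fv: "\<And>y. y \<in> S \<Longrightarrow> ((\<lambda>y. f' y v) has_derivative fv y) (at y)"
    and cont: "isCont (\<lambda>y. fu y v) x" "isCont (\<lambda>y. fv y u) x"
  shows "fu x v = fv x u"
proof -
  obtain r where r: "r > 0" "ball x r \<subseteq> S" using S openE by blast
  have "\<bar>fu x v - fv x u\<bar> \<le> e" if e: "e > 0" for e
  proof -
    obtain d where d: "d > 0" "\<And>y. norm (y - x) < d \<Longrightarrow> norm (fu y v - fu x v) < e / 2"
      using cont(1)[unfolded continuous_at_eps_delta dist_norm, rule_format, OF half_gt_zero[OF e]]
      by blast
    obtain d' where d': "d' > 0" "\<And>y. norm (y - x) < d' \<Longrightarrow> norm (fv y u - fv x u) < e / 2"
      using cont(2)[unfolded continuous_at_eps_delta dist_norm, rule_format, OF half_gt_zero[OF e]]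
      by blast
    define m where "m = min r (min d d')"
    have m: "m > 0" using r d d' by (simp add: m_def)
    define N where "N = norm u + norm v"
    have N: "N \<ge> 0" by (simp add: N_def)
    \<comment> \<open>Adding 1 to the denominator covers the case \<open>u = v = 0\<close>.\<close>
    define h where "h = m / (N + 1)"
    have h: "h > 0" using m N by (simp add: h_def)
    have "h * N < m"
      using m N by (simp add: h_def field_simps)
    then have hm: "h * (norm u + norm v) < r" "h * (norm u + norm v) < d" "h * (norm u + norm v) < d'"
      by (auto simp: m_def N_def)
    obtain y where y: "norm (y - x) \<le> h * (norm u + norm v)"
      "f (x + h *\<^sub>R u + h *\<^sub>R v) - f (x + h *\<^sub>R u) - f (x + h *\<^sub>R v) + f x = h * h * fu y v"
      using mixed_difference_mean_value[of x r f f' u fu h v] f fu r h hm by blast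
    obtain z where z: "norm (z - x) \<le> h * (norm v + norm u)"
      "f (x + h *\<^sub>R v + h *\<^sub>R u) - f (x + h *\<^sub>R v) - f (x + h *\<^sub>R u) + f x = h * h * fv z u"
      using mixed_difference_mean_value[of x r f f' v fv h u] f fv r h hm
      by (metis add.commute subset_eq)
    have "h * h * fu y v = h * h * fv z u"
      unfolding y(2)[symmetric] z(2)[symmetric] by (simp add: ac_simps)
    then have "fu y v = fv z u" using h by simp
    moreover have "\<bar>fu y v - fu x v\<bar> < e / 2" using d(2) y(1) hm by simp
    moreover have "\<bar>fv z u - fv x u\<bar> < e / 2" using d'(2) z(1) hm by (simp add: add.commute)
    ultimately show ?thesis by linarith
  qed
  then have "\<bar>fu x v - fv x u\<bar> \<le> 0" by (rule field_le_epsilon) simp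
  then show ?thesis by simp
qed

text \<open>
  Reduces to real-valued maps by taking inner products with a fixed vector.
\<close>

lemma second_derivative_symmetric:
  fixes f :: "'a::real_normed_vector \<Rightarrow> 'b::real_inner"
  assumes S: "open S" "x \<in> S" and f: "smooth_on S f"
  shows "frechet_derivative (\<lambda>y. frechet_derivative f (at y) u) (at x) v =
         frechet_derivative (\<lambda>y. frechet_derivative f (at y) v) (at x) u"
proof -
  let ?D = "\<lambda>u y v. frechet_derivative (\<lambda>y. frechet_derivative f (at y) u) (at y) v"
  have cont: "isCont (\<lambda>y. inner (?D u y v) w) x" for u v w
    using smooth_on_imp_continuous_on[OF smooth_on_frechet_derivative[OF smooth_on_frechet_derivative[OF f]]]
      S by (intro continuous_intros) (simp add: continuous_on_eq_continuous_at)
  have "inner (?D u x v) w = inner (?D v x u) w" for w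
  proof (rule mixed_second_derivatives_eq[where f = "\<lambda>y. inner (f y) w"
        and f' = "\<lambda>y h. inner (frechet_derivative f (at y) h) w"
        and fu = "\<lambda>y h. inner (?D u y h) w" and fv = "\<lambda>y h. inner (?D v y h) w", OF S])
    note D = has_derivative_inner_left[OF smooth_on_has_derivative]
    show "((\<lambda>y. inner (f y) w) has_derivative (\<lambda>h. inner (frechet_derivative f (at y) h) w)) (at y)"
      if "y \<in> S" for y
      by (rule D[OF f that])
    show "((\<lambda>y. inner (frechet_derivative f (at y) u) w) has_derivative (\<lambda>h. inner (?D u y h) w)) (at y)"
      if "y \<in> S" for y
      by (rule D[OF smooth_on_frechet_derivative[OF f] that])
    show "((\<lambda>y. inner (frechet_derivative f (at y) v) w) has_derivative (\<lambda>h. inner (?D v y h) w)) (at y)"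
      if "y \<in> S" for y
      by (rule D[OF smooth_on_frechet_derivative[OF f] that])
  qed (rule cont)+
  then show ?thesis using vector_eq_rdot by blast
qed

text \<open>
  The product rule for the pairing of a family of linear maps with a vector field, by expansion in the
  orthonormal basis.
\<close>

lemma has_derivative_apply_family:
  fixes L :: "'a::real_normed_vector \<Rightarrow> 'b::finite_dim_inner \<Rightarrow> 'c::real_normed_vector"
  assumes S: "open S" "x \<in> S" and lin: "\<And>y. y \<in> S \<Longrightarrow> linear (L y)"
    and L: "\<And>w. ((\<lambda>y. L y w) has_derivative L' w) (at x)" and v: "(v has_derivative v') (at x)"
  shows "((\<lambda>y. L y (v y)) has_derivative (\<lambda>h. L' (v x) h + L x (v' h))) (at x)"
proof -
  have exp: "L y w = (\<Sum>b\<in>onb. inner w b *\<^sub>R L y b)" if "y \<in> S" for y w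
    by (rule linear_onb_expansion[OF lin[OF that]])
  have "((\<lambda>y. \<Sum>b\<in>onb. inner w b *\<^sub>R L y b) has_derivative (\<lambda>h. \<Sum>b\<in>onb. inner w b *\<^sub>R L' b h)) (at x)" for w
    by (auto intro!: derivative_eq_intros L)
  then have "((\<lambda>y. L y w) has_derivative (\<lambda>h. \<Sum>b\<in>onb. inner w b *\<^sub>R L' b h)) (at x)" for w
    by (rule has_derivative_transform_within_open[OF _ S]) (metis exp)
  \<comment> \<open>The derivative \<open>L'\<close> is automatically linear in the vector argument.\<close>
  then have L'exp: "L' w = (\<lambda>h. \<Sum>b\<in>onb. inner w b *\<^sub>R L' b h)" for w
    using has_derivative_unique[OF L] by blast
  have "((\<lambda>y. \<Sum>b\<in>onb. inner (v y) b *\<^sub>R L y b) has_derivative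
      (\<lambda>h. \<Sum>b\<in>onb. inner (v x) b *\<^sub>R L' b h + inner (v' h) b *\<^sub>R L x b)) (at x)"
    by (intro has_derivative_sum has_derivative_scaleR has_derivative_inner_left v L)
  also have "(\<lambda>h. \<Sum>b\<in>onb. inner (v x) b *\<^sub>R L' b h + inner (v' h) b *\<^sub>R L x b)
      = (\<lambda>h. L' (v x) h + L x (v' h))"
    by (subst L'exp) (simp add: sum.distrib exp[OF S(2), of "v' _"])
  finally show ?thesis
    by (rule has_derivative_transform_within_open[OF _ S]) (metis exp)
qed

text \<open>
  The Lie bracket of vector fields on a model space.
\<close>

definition coord_bracket ::
  "('e::real_normed_vector \<Rightarrow> 'e) \<Rightarrow> ('e \<Rightarrow> 'e) \<Rightarrow> 'e \<Rightarrow> 'e" where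
  "coord_bracket v w x = frechet_derivative w (at x) (v x) - frechet_derivative v (at x) (w x)"

lemma smooth_coord_bracket:
  fixes v w :: "'e::finite_dim_inner \<Rightarrow> 'e"
  assumes S: "open S" and v: "smooth_on S v" and w: "smooth_on S w"
  shows "smooth_on S (coord_bracket v w)"
  unfolding coord_bracket_def[abs_def]
  by (rule smooth_on_diff[OF S smooth_on_derivative_apply[OF S w v] smooth_on_derivative_apply[OF S v w]])

text \<open>
  By the product rule, \<open>\<partial>\<^sub>v (DF w) = D\<^sup>2F (v, w) + DF (Dw v)\<close>. The second-order terms cancel in the
  difference because \<open>D\<^sup>2F\<close> is symmetric.
\<close>

lemma derivative_of_bracket:
  fixes F :: "'a::finite_dim_inner \<Rightarrow> 'b::real_inner"
  assumes S: "open S" "x \<in> S" and F: "smooth_on S F"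
    and v: "v differentiable (at x)" and w: "w differentiable (at x)"
  shows "frechet_derivative F (at x)
      (frechet_derivative w (at x) (v x) - frechet_derivative v (at x) (w x)) =
    frechet_derivative (\<lambda>y. frechet_derivative F (at y) (w y)) (at x) (v x) -
    frechet_derivative (\<lambda>y. frechet_derivative F (at y) (v y)) (at x) (w x)"
proof -
  have *: "frechet_derivative (\<lambda>y. frechet_derivative F (at y) (w y)) (at x) =
      (\<lambda>h. frechet_derivative (\<lambda>y. frechet_derivative F (at y) (w x)) (at x) h
        + frechet_derivative F (at x) (frechet_derivative w (at x) h))"
    if "w differentiable (at x)" for w
    by (rule frechet_derivative_eq[OF has_derivative_apply_family[OF S]])
      (use that S(2) smooth_on_linear_derivative[OF F]
          smooth_on_has_derivative[OF smooth_on_frechet_derivative[OF F]]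
        in \<open>auto simp: frechet_derivative_works\<close>)
  show ?thesis
    using second_derivative_symmetric[OF S F, of "v x" "w x"]
    by (simp add: *[OF v] *[OF w] linear_diff[OF smooth_on_linear_derivative[OF F S(2)]])
qed

text \<open>
  The relations \<open>DF a = J (DF b)\<close> and \<open>DF c = J (DF d)\<close> hold on an open set and \<open>J\<close> is constant, so they
  survive differentiation in any direction. Inserting them into the expansion
  \<open>[a + \<i> b, c + \<i> d] = ([a, c] - [b, d]) + \<i> ([a, d] + [b, c])\<close> with \<open>derivative_of_bracket\<close> makes all
  terms cancel.
\<close>

lemma antiholomorphic_part_bracket:
  fixes F :: "'a::finite_dim_inner \<Rightarrow> 'b::complex_model"
  assumes S: "open S" "x \<in> S" and F: "smooth_on S F"
    and smooth: "smooth_on S a" "smooth_on S b" "smooth_on S c" "smooth_on S d"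
    and ab: "\<And>y. y \<in> S \<Longrightarrow> antiholomorphic_part (frechet_derivative F (at y)) (a y, b y) = 0"
    and cd: "\<And>y. y \<in> S \<Longrightarrow> antiholomorphic_part (frechet_derivative F (at y)) (c y, d y) = 0"
  shows "antiholomorphic_part (frechet_derivative F (at x))
    (coord_bracket a c x - coord_bracket b d x, coord_bracket a d x + coord_bracket b c x) = 0"
proof -
  let ?T = "\<lambda>v y. frechet_derivative F (at y) (v y)"
  let ?D = "\<lambda>v. frechet_derivative (?T v) (at x)"
  have lin: "linear (frechet_derivative F (at y))" if "y \<in> S" for y
    by (rule smooth_on_linear_derivative[OF F that])
  have smT: "smooth_on S (?T v)" if "smooth_on S v" for v
    by (rule smooth_on_derivative_apply[OF S(1) F that])
  have rel: "?D v h = imult (?D w h)"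
    if "smooth_on S w" and vw: "\<And>y. y \<in> S \<Longrightarrow> antiholomorphic_part (frechet_derivative F (at y)) (v y, w y) = 0"
    for v w h
  proof -
    have "((\<lambda>y. imult (?T w y)) has_derivative (\<lambda>h. imult (?D w h))) (at x)"
      by (rule bounded_linear.has_derivative[OF linear_imp_bounded_linear[OF linear_imult]
            smooth_on_has_derivative[OF smT[OF that(1)] S(2)]])
    then have "(?T v has_derivative (\<lambda>h. imult (?D w h))) (at x)"
      by (rule has_derivative_transform_within_open[OF _ S])
        (use vw in \<open>simp add: antiholomorphic_part_def\<close>)
    then show ?thesis by (simp add: frechet_derivative_eq)
  qed
  have br: "frechet_derivative F (at x) (coord_bracket v w x) = ?D w (v x) - ?D v (w x)"
    if "smooth_on S v" "smooth_on S w" for v w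
    unfolding coord_bracket_def
    using derivative_of_bracket[OF S F] smooth_on_has_derivative[OF that(1) S(2)]
      smooth_on_has_derivative[OF that(2) S(2)] by (auto simp: differentiable_def)
  show ?thesis
    by (simp add: antiholomorphic_part_def linear_diff[OF lin[OF S(2)]] linear_add[OF lin[OF S(2)]]
        br smooth rel[OF smooth(2) ab] rel[OF smooth(4) cd] linear_diff[OF linear_imult]
        linear_add[OF linear_imult] imult_imult algebra_simps)
qed

section \<open>Kernels of smooth families of surjective maps\<close>

text \<open>
  Let \<open>R\<close> be a complex-linear right inverse of \<open>L p\<close>. The maps \<open>M x = L x \<circ> R\<close> equal the identity at \<open>p\<close>,
  hence are invertible nearby with smoothly varying inverse \<open>G x\<close>, and \<open>\<pi> x = id - R \<circ> G x \<circ> L x\<close> projects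
  onto the kernel of \<open>L x\<close> along the range of \<open>R\<close>. That range is complementary to the kernel \<open>K\<close> of \<open>L p\<close>,
  so \<open>\<pi> x\<close> maps \<open>K\<close> isomorphically onto the kernel of \<open>L x\<close>, and complex bases to complex bases.
\<close>

lemma smooth_kernel_frame:
  fixes L :: "'a::finite_dim_inner \<Rightarrow> 'b::finite_dim_inner \<Rightarrow> 'c::finite_dim_inner"
  assumes S: "open S" "p \<in> S"
    and lin: "\<And>x. x \<in> S \<Longrightarrow> linear (L x)" and smooth: "\<And>w. smooth_on S (\<lambda>x. L x w)"
    and I: "linear I" "\<And>w. I (I w) = - w" and J: "linear J" "\<And>y. J (J y) = - y"
    and LI: "\<And>x w. x \<in> S \<Longrightarrow> L x (I w) = J (L x w)"
    and surj: "surj (L p)" and dim: "dim (UNIV :: 'b set) = 2 * m + dim (UNIV :: 'c set)"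
  obtains T s where "open T" "p \<in> T" "T \<subseteq> S" "\<And>i. smooth_on T (s i)"
    "\<And>x w. x \<in> T \<Longrightarrow> L x w = 0 \<longleftrightarrow> (\<exists>z. w = (\<Sum>i<m. complex_scale I (z i) (s i x)))"
    "\<And>x z. x \<in> T \<Longrightarrow> (\<Sum>i<m. complex_scale I (z i) (s i x)) = 0 \<Longrightarrow> \<forall>i<m. z i = 0"
proof -
  note linp = lin[OF S(2)]
  define K where "K = {w. L p w = 0}"
  have K: "subspace K" "\<And>w. w \<in> K \<Longrightarrow> I w \<in> K"
    using linp by (auto simp: K_def linear_subspace_kernel LI[OF S(2)] linear_0[OF J(1)])
  have "dim K = 2 * m"
    using rank_nullity[OF linp surj] dim by (simp add: K_def)
  then obtain w :: "nat \<Rightarrow> 'b" where w: "\<And>i. i < m \<Longrightarrow> w i \<in> K"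
    "\<And>u. u \<in> K \<Longrightarrow> \<exists>z. u = (\<Sum>i<m. complex_scale I (z i) (w i))"
    "\<And>z. (\<Sum>i<m. complex_scale I (z i) (w i)) = 0 \<Longrightarrow> \<forall>i<m. z i = 0"
    using exists_complex_basis[OF I K] by auto
  obtain R where R: "linear R" "\<And>y. L p (R y) = y" "\<And>y. R (J y) = I (R y)"
    by (rule complex_linear_right_inverse[where f = "L p" and I = I and J = J])
      (use linp surj I J LI[OF S(2)] in auto)
  define M where "M x y = L x (R y)" for x y
  have linM: "linear (M x)" if "x \<in> S" for x
    unfolding M_def using linear_compose[OF R(1) lin[OF that]] by (simp add: comp_def)
  have smoothM: "smooth_on S (\<lambda>x. M x y)" for y unfolding M_def by (rule smooth)
  \<comment> \<open>The operator distance of \<open>M x\<close> from the identity is at most the sum below; staying under 1/2 keeps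
    \<open>M x\<close> bounded below by 1/2, hence invertible.\<close>
  define T where "T = {x \<in> S. (\<Sum>b\<in>onb. norm (M x b - b)) < 1/2}"
  have "continuous_on S (\<lambda>x. \<Sum>b\<in>onb. norm (M x b - b))"
    by (intro continuous_intros smooth_on_imp_continuous_on smoothM)
  from continuous_open_preimage[OF this S(1) open_lessThan]
  have "open (S \<inter> (\<lambda>x. \<Sum>b\<in>onb. norm (M x b - b)) -` {..<1/2})" .
  also have "S \<inter> (\<lambda>x. \<Sum>b\<in>onb. norm (M x b - b)) -` {..<1/2} = T" by (auto simp: T_def)
  finally have T: "open T" .
  have pT: "p \<in> T" using S(2) by (simp add: T_def M_def R(2))
  have TS: "T \<subseteq> S" by (auto simp: T_def)
  have bound: "norm y / 2 \<le> norm (M x y)" if x: "x \<in> T" for x y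
  proof -
    have "linear (\<lambda>y. M x y - y)"
      using linear_compose_sub[OF linM linear_ident] x TS by blast
    then have "norm (M x y - y) = norm (\<Sum>b\<in>onb. inner y b *\<^sub>R (M x b - b))"
      by (subst linear_onb_expansion[of "\<lambda>y. M x y - y" y]) simp_all
    also have "\<dots> \<le> (\<Sum>b\<in>onb. norm y * norm (M x b - b))"
    proof (rule sum_norm_le)
      fix b :: 'c assume b: "b \<in> onb"
      have "norm b = 1" using inner_onb[OF b b] by (simp add: norm_eq_sqrt_inner)
      then have "\<bar>inner y b\<bar> \<le> norm y" using Cauchy_Schwarz_ineq2[of y b] by simp
      then show "norm (inner y b *\<^sub>R (M x b - b)) \<le> norm y * norm (M x b - b)"
        by (simp add: mult_right_mono)
    qed
    also have "\<dots> = norm y * (\<Sum>b\<in>onb. norm (M x b - b))" by (rule sum_distrib_left[symmetric])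
    also have "\<dots> \<le> norm y * (1/2)" using x by (intro mult_left_mono) (auto simp: T_def)
    finally show ?thesis using norm_triangle_ineq2[of y "M x y"] by (simp add: norm_minus_commute)
  qed
  have injM: "u = v" if "x \<in> T" "M x u = M x v" for x u v
  proof -
    have "linear (M x)" using linM that TS by blast
    then show ?thesis using bound[OF that(1), of "u - v"] that(2) by (simp add: linear_diff)
  qed
  define G where "G x y = inv (M x) y" for x y
  have MG: "M x (G x y) = y" if "x \<in> T" for x y
  proof -
    have "linear (M x)" using linM that TS by blast
    moreover have "inj (M x)" using injM[OF that] by (simp add: inj_def)
    ultimately have "surj (M x)" by (rule fin_dim.linear_inj_imp_surj)
    then show ?thesis by (simp add: G_def surj_f_inv_f)
  qed
  have GM: "G x (M x y) = y" if "x \<in> T" for x y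
    by (rule injM[OF that]) (simp add: MG[OF that])
  have linG: "linear (G x)" if x: "x \<in> T" for x
  proof -
    have "linear (M x)" using linM that TS by blast
    then show ?thesis
      by - (rule linearI; rule injM[OF x]; simp add: MG[OF x] linear_add linear_cmul)
  qed
  have smoothG: "smooth_on T (\<lambda>x. G x y)" for y
    unfolding smooth_on_def
  proof (intro allI Ck_on_inverse_family[where M = M, OF T _ _ bound MG])
    show "linear (M x)" if "x \<in> T" for x using linM that TS by blast
    show "Ck_on n T (\<lambda>x. M x w)" for n w
      using smooth_on_subset[OF smoothM TS] by (simp add: smooth_on_def)
  qed
  have GJ: "G x (J y) = J (G x y)" if x: "x \<in> T" for x y
  proof (rule injM[OF x])
    have "M x (J (G x y)) = J (M x (G x y))" using LI TS x by (simp add: M_def R(3) subset_iff)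
    then show "M x (G x (J y)) = M x (J (G x y))" by (simp add: MG[OF x])
  qed
  define \<pi> where "\<pi> x u = u - R (G x (L x u))" for x u
  have lin\<pi>: "linear (\<pi> x)" if x: "x \<in> T" for x
  proof -
    have "linear (L x)" using lin x TS by blast
    from linear_compose[OF linear_compose[OF this linG[OF x]] R(1)]
    show ?thesis unfolding \<pi>_def by (intro linear_compose_sub linear_ident) (simp add: comp_def)
  qed
  have \<pi>I: "\<pi> x (I u) = I (\<pi> x u)" if x: "x \<in> T" for x u
    using x TS by (simp add: \<pi>_def LI subset_iff GJ R(3) linear_diff[OF I(1)])
  have L\<pi>: "L x (\<pi> x u) = 0" if x: "x \<in> T" for x u
  proof -
    have "linear (L x)" using lin x TS by blast
    then show ?thesis using MG[OF x, of "L x u"] by (simp add: \<pi>_def linear_diff M_def)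
  qed
  have \<pi>R: "\<pi> x (R y) = 0" if x: "x \<in> T" for x y
    using GM[OF x, of y] by (simp add: \<pi>_def M_def)
  have sum\<pi>: "(\<Sum>i<m. complex_scale I (z i) (\<pi> x (w i))) = \<pi> x (\<Sum>i<m. complex_scale I (z i) (w i))"
    if x: "x \<in> T" for x z
    by (simp add: linear_sum[OF lin\<pi>[OF x]] 
        linear_complex_scale[where I = I and J = I, OF lin\<pi>[OF x] \<pi>I[OF x]])
  show ?thesis
  proof (rule that[OF T pT TS, of "\<lambda>i x. \<pi> x (w i)"])
    show "smooth_on T (\<lambda>x. \<pi> x (w i))" for i
      unfolding \<pi>_def
      by (intro smooth_on_diff[OF T] smooth_on_const smooth_on_linear[OF T linear_imp_bounded_linear[OF R(1)]]
          smooth_on_apply_family[OF T linG smoothG] smooth_on_subset[OF smooth TS])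
    show "L x u = 0 \<longleftrightarrow> (\<exists>z. u = (\<Sum>i<m. complex_scale I (z i) (\<pi> x (w i))))" if x: "x \<in> T" for x u
    proof
      assume Lu: "L x u = 0"
      have "u - R (L p u) \<in> K" using linp by (simp add: K_def linear_diff R(2))
      then obtain z where z: "u - R (L p u) = (\<Sum>i<m. complex_scale I (z i) (w i))" using w(2) by blast
      \<comment> \<open>Elements of the kernel of \<open>L x\<close> are fixed by \<open>\<pi> x\<close>, which annihilates the
        range of \<open>R\<close>.\<close>
      have "u = \<pi> x u" by (simp add: \<pi>_def Lu linear_0[OF linG[OF x]] linear_0[OF R(1)])
      also have "\<dots> = \<pi> x (u - R (L p u))" by (simp add: linear_diff[OF lin\<pi>[OF x]] \<pi>R[OF x])
      finally have "u = (\<Sum>i<m. complex_scale I (z i) (\<pi> x (w i)))" by (simp only: z sum\<pi>[OF x])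
      then show "\<exists>z. u = (\<Sum>i<m. complex_scale I (z i) (\<pi> x (w i)))" by blast
    next
      assume "\<exists>z. u = (\<Sum>i<m. complex_scale I (z i) (\<pi> x (w i)))"
      then show "L x u = 0" by (auto simp: sum\<pi>[OF x] L\<pi>[OF x])
    qed
    show "\<forall>i<m. z i = 0" if x: "x \<in> T" and z: "(\<Sum>i<m. complex_scale I (z i) (\<pi> x (w i))) = 0" for x z
    proof (rule w(3))
      let ?W = "\<Sum>i<m. complex_scale I (z i) (w i)"
      have "?W \<in> K"
        using w(1) K by (auto intro!: subspace_sum subspace_add subspace_scale simp: complex_scale_def)
      then have "L p ?W = 0" by (simp add: K_def)
      moreover have "?W = R (G x (L x ?W))" using z unfolding sum\<pi>[OF x] by (simp add: \<pi>_def)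
      ultimately show "?W = 0" by (metis R(1,2) linear_0)
    qed
  qed
qed

section \<open>Charts and coordinate expressions\<close>

lemma top_atlas_chart:
  assumes "top_atlas A" and "c \<in> A"
  shows "open (fst c)" "homeomorphism (fst c) (snd c ` fst c) (snd c) (chart_inv c)"
    and "open (snd c ` fst c)"
  using assms by (auto simp: top_atlas_def)

lemma obtain_chart_at:
  assumes "top_atlas A"
  obtains c where "c \<in> charts_at A p"
  using assms unfolding top_atlas_def by (meson ex_in_conv)

lemma charts_atD: "c \<in> charts_at A p \<Longrightarrow> c \<in> A" "c \<in> charts_at A p \<Longrightarrow> p \<in> fst c"
  by (auto simp: charts_at_def)

lemma chart_inv_chart:
  "top_atlas A \<Longrightarrow> c \<in> A \<Longrightarrow> p \<in> fst c \<Longrightarrow> chart_inv c (snd c p) = p"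
  using top_atlas_chart(2)[of A c] by (simp add: homeomorphism_def)

lemma open_chart_image:
  assumes "top_atlas A" "c \<in> A" "open V" "V \<subseteq> fst c"
  shows "open (snd c ` V)"
proof -
  note chart = top_atlas_chart[OF assms(1,2)]
  have "openin (top_of_set (fst c)) V"
    using assms(3,4) by (simp add: openin_open_eq[OF chart(1)])
  then have "openin (top_of_set (snd c ` fst c)) (snd c ` V)"
    by (rule homeomorphism_imp_open_map[OF chart(2)])
  then show ?thesis by (simp add: openin_open_eq[OF chart(3)])
qed

lemma open_chart_preimage:
  assumes "top_atlas A" "c \<in> A" "open T"
  shows "open (fst c \<inter> snd c -` T)"
proof -
  note chart = top_atlas_chart[OF assms(1,2)]
  have "continuous_on (fst c) (snd c)" using chart(2) by (simp add: homeomorphism_def)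
  from continuous_open_preimage[OF this chart(1) assms(3)] show ?thesis .
qed

lemma open_coord_dom:
  assumes "top_atlas A" "top_atlas B" "c \<in> A" "d \<in> B" "continuous_on UNIV f"
  shows "open (coord_dom c d f)"
proof -
  have "open (f -` fst d)"
    using continuous_open_preimage[OF assms(5) open_UNIV top_atlas_chart(1)[OF assms(2,4)]] by simp
  then show ?thesis
    unfolding coord_dom_def
    by (intro open_chart_image[OF assms(1,3)] open_Int top_atlas_chart(1)[OF assms(1,3)]) auto
qed

lemma coord_domI: "p \<in> fst c \<Longrightarrow> f p \<in> fst d \<Longrightarrow> snd c p \<in> coord_dom c d f"
  by (auto simp: coord_dom_def)

lemma coord_domE:
  assumes "top_atlas A" "c \<in> A" "x \<in> coord_dom c d f"
  obtains p where "p \<in> fst c" "f p \<in> fst d" "x = snd c p" "chart_inv c x = p"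
  using assms chart_inv_chart[OF assms(1,2)] by (auto simp: coord_dom_def)

lemma chart_in_coord_dom_iff:
  assumes "top_atlas A" "c \<in> A" "p \<in> fst c"
  shows "snd c p \<in> coord_dom c d f \<longleftrightarrow> f p \<in> fst d"
proof
  assume "snd c p \<in> coord_dom c d f"
  then obtain q where q: "q \<in> fst c" "f q \<in> fst d" "snd c p = snd c q" by (auto simp: coord_dom_def)
  have "p = q"
    using chart_inv_chart[OF assms] chart_inv_chart[OF assms(1,2) q(1)] q(3) by metis
  then show "f p \<in> fst d" using q(2) by simp
qed (rule coord_domI[OF assms(3)])

lemma coord_rep_chart:
  "top_atlas A \<Longrightarrow> c \<in> A \<Longrightarrow> p \<in> fst c \<Longrightarrow> coord_rep c d f (snd c p) = snd d (f p)"
  by (simp add: coord_rep_def chart_inv_chart)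

lemma coord_rep_comp:
  assumes "top_atlas A" "top_atlas B" "c \<in> A" "d \<in> B" "x \<in> coord_dom c d f"
  shows "coord_rep c e (g \<circ> f) x = coord_rep d e g (coord_rep c d f x)"
  using assms(5)
  by (rule coord_domE[OF assms(1,3)])
    (simp add: coord_rep_chart[OF assms(1,3)] coord_rep_chart[OF assms(2,4)])

lemma smooth_mapD:
  assumes "smooth_map A B f"
  shows "continuous_on UNIV f"
    and "c \<in> A \<Longrightarrow> d \<in> B \<Longrightarrow> smooth_on (coord_dom c d f) (coord_rep c d f)"
  using assms by (auto simp: smooth_map_def)

lemma coord_rep_has_derivative:
  assumes "smooth_map A B f" "c \<in> A" "d \<in> B" "p \<in> fst c" "f p \<in> fst d"
  shows "(coord_rep c d f has_derivative frechet_derivative (coord_rep c d f) (at (snd c p))) (at (snd c p))"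
  by (rule smooth_on_has_derivative[OF smooth_mapD(2)[OF assms(1-3)] coord_domI[of p c f d, OF assms(4,5)]])

lemmas linear_coord_derivative = has_derivative_linear[OF coord_rep_has_derivative]

text \<open>
  With \<open>f\<close> or \<open>g\<close> the identity, this becomes the cocycle rule of transition maps, or the independence of
  the differential from the choice of charts.
\<close>

lemma coord_derivative_comp:
  assumes "top_atlas A" "top_atlas B" "smooth_map A B f" "smooth_map B C g"
    and c: "c \<in> A" "d \<in> B" "e \<in> C" and p: "p \<in> fst c" "f p \<in> fst d" "g (f p) \<in> fst e"
  shows "frechet_derivative (coord_rep c e (g \<circ> f)) (at (snd c p)) =
    (\<lambda>v. frechet_derivative (coord_rep d e g) (at (snd d (f p)))
      (frechet_derivative (coord_rep c d f) (at (snd c p)) v))"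
proof (rule frechet_derivative_eq)
  have "(coord_rep d e g has_derivative frechet_derivative (coord_rep d e g) (at (snd d (f p))))
      (at (coord_rep c d f (snd c p)))"
    using coord_rep_has_derivative[OF assms(4) c(2,3) p(2,3)]
    by (simp add: coord_rep_chart[OF assms(1) c(1) p(1)])
  note this [THEN has_derivative_compose[OF coord_rep_has_derivative[OF assms(3) c(1,2) p(1,2)]]]
  then show "(coord_rep c e (g \<circ> f) has_derivative
      (\<lambda>v. frechet_derivative (coord_rep d e g) (at (snd d (f p)))
        (frechet_derivative (coord_rep c d f) (at (snd c p)) v))) (at (snd c p))"
  proof (rule has_derivative_transform_within_open)
    show "open (coord_dom c d f)"
      by (rule open_coord_dom[OF assms(1,2) c(1,2) smooth_mapD(1)[OF assms(3)]])
    show "snd c p \<in> coord_dom c d f" using p by (simp add: coord_domI)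
    show "coord_rep d e g (coord_rep c d f x) = coord_rep c e (g \<circ> f) x" if "x \<in> coord_dom c d f" for x
      by (rule coord_rep_comp[OF assms(1,2) c(1,2) that, symmetric])
  qed
qed

text \<open>
  Near each point the composition factors through a chart of the middle manifold; smoothness is a local
  property.
\<close>

lemma smooth_map_comp:
  assumes A: "top_atlas A" and B: "top_atlas B" and C: "top_atlas C"
    and f: "smooth_map A B f" and g: "smooth_map B C g"
  shows "smooth_map A C (g \<circ> f)"
  unfolding smooth_map_def
proof (intro conjI ballI)
  show cont: "continuous_on UNIV (g \<circ> f)"
    by (rule continuous_on_compose[OF smooth_mapD(1)[OF f]
          continuous_on_subset[OF smooth_mapD(1)[OF g] subset_UNIV]])
  fix c e assume c: "c \<in> A" and e: "e \<in> C"
  show "smooth_on (coord_dom c e (g \<circ> f)) (coord_rep c e (g \<circ> f))"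
  proof (rule smooth_on_locally)
    fix x assume "x \<in> coord_dom c e (g \<circ> f)"
    then obtain p where p: "p \<in> fst c" "g (f p) \<in> fst e" "x = snd c p"
      by (auto simp: coord_dom_def)
    obtain d where "d \<in> charts_at B (f p)" by (rule obtain_chart_at[OF B])
    then have d: "d \<in> B" "f p \<in> fst d" by (auto simp: charts_at_def)
    let ?T = "coord_dom c d f \<inter> coord_dom c e (g \<circ> f)"
    have T: "open ?T"
      by (intro open_Int open_coord_dom[OF A B c d(1) smooth_mapD(1)[OF f]] open_coord_dom[OF A C c e cont])
    have "coord_rep c d f ` ?T \<subseteq> coord_dom d e g"
    proof clarify
      fix y assume y: "y \<in> coord_dom c d f" "y \<in> coord_dom c e (g \<circ> f)"
      from y(1) obtain q where q: "q \<in> fst c" "f q \<in> fst d" "y = snd c q" "chart_inv c y = q"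
        by (rule coord_domE[OF A c])
      from y(2) have "g (f q) \<in> fst e"
        by (rule coord_domE[OF A c]) (simp add: q(4)[symmetric])
      then show "coord_rep c d f y \<in> coord_dom d e g"
        using q by (simp add: coord_rep_chart[OF A c] coord_domI)
    qed
    then have "smooth_on ?T (\<lambda>x. coord_rep d e g (coord_rep c d f x))"
      by (rule smooth_on_compose[OF T smooth_on_subset[OF smooth_mapD(2)[OF f c d(1)] Int_lower1]
          smooth_mapD(2)[OF g d(1) e]])
    then have "smooth_on ?T (coord_rep c e (g \<circ> f))"
      by (rule smooth_on_cong[OF T, rotated]) (simp add: coord_rep_comp[OF A B c d(1)])
    moreover have "x \<in> ?T" using p d by (auto simp: coord_dom_def)
    ultimately show "\<exists>T. open T \<and> x \<in> T \<and> smooth_on T (coord_rep c e (g \<circ> f))" using T by blast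
  qed
qed

lemma smooth_manifold_iff: "smooth_manifold A \<longleftrightarrow> top_atlas A \<and> smooth_map A A id"
  by (auto simp: smooth_manifold_def smooth_map_def)

lemma complex_manifold_imp_smooth_manifold: "complex_manifold A \<Longrightarrow> smooth_manifold A"
  by (auto simp: complex_manifold_def smooth_manifold_def holo_on_def)

lemma smooth_manifoldD:
  assumes "smooth_manifold A"
  shows "top_atlas A" "smooth_map A A id"
  using assms by (auto simp: smooth_manifold_iff)

lemma holomorphic_map_imp_smooth_map: "holomorphic_map A B f \<Longrightarrow> smooth_map A B f"
  by (auto simp: holomorphic_map_def smooth_map_def holo_on_def)

lemma holomorphic_map_derivative_imult:
  assumes "holomorphic_map A B f" "c \<in> charts_at A p" "d \<in> charts_at B (f p)"
  shows "frechet_derivative (coord_rep c d f) (at (snd c p)) (imult v) =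
    imult (frechet_derivative (coord_rep c d f) (at (snd c p)) v)"
  using assms coord_domI[of p c f d] by (auto simp: holomorphic_map_def holo_on_def charts_at_def)

lemma complex_manifold_holomorphic_id: "complex_manifold A \<Longrightarrow> holomorphic_map A A id"
  by (auto simp: complex_manifold_def holomorphic_map_def)

section \<open>Tangent vectors and differentials\<close>

text \<open>
  The tangent vector at \<open>p\<close> with prescribed component \<open>x\<close> in the chart \<open>c\<close>.
\<close>

definition tangent_of ::
  "('a, 'e::real_normed_vector) chart set \<Rightarrow> ('a, 'e) chart \<Rightarrow> 'a \<Rightarrow> 'e \<Rightarrow> ('a, 'e) tvec" where
  "tangent_of A c p x = (\<lambda>d. if d \<in> charts_at A p
     then frechet_derivative (coord_rep c d id) (at (snd c p)) x else 0)"

lemma tangent_space_transition: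
  assumes "v \<in> tangent_space A p" "c \<in> charts_at A p" "d \<in> charts_at A p"
  shows "v d = frechet_derivative (coord_rep c d id) (at (snd c p)) (v c)"
  using assms unfolding tangent_space_def by blast

lemma tangent_space_outside: "v \<in> tangent_space A p \<Longrightarrow> c \<notin> charts_at A p \<Longrightarrow> v c = 0"
  unfolding tangent_space_def by blast

lemma tangent_spaceI:
  assumes "\<And>c d. c \<in> charts_at A p \<Longrightarrow> d \<in> charts_at A p \<Longrightarrow>
      v d = frechet_derivative (coord_rep c d id) (at (snd c p)) (v c)"
    and "\<And>c. c \<notin> charts_at A p \<Longrightarrow> v c = 0"
  shows "v \<in> tangent_space A p"
  using assms unfolding tangent_space_def by blast

context
  fixes A :: "('a::{t2_space, second_countable_topology}, 'e::finite_dim_inner) chart set"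
  assumes A: "smooth_manifold A"
begin

lemma transition_comp:
  assumes "c \<in> charts_at A p" "d \<in> charts_at A p" "e \<in> charts_at A p"
  shows "frechet_derivative (coord_rep c e id) (at (snd c p)) v =
    frechet_derivative (coord_rep d e id) (at (snd d p)) (frechet_derivative (coord_rep c d id) (at (snd c p)) v)"
  using coord_derivative_comp[OF smooth_manifoldD(1)[OF A] smooth_manifoldD(1)[OF A]
      smooth_manifoldD(2)[OF A] smooth_manifoldD(2)[OF A], of c d e p] assms
  by (simp add: charts_at_def)

lemma linear_transition:
  assumes "c \<in> charts_at A p" "d \<in> charts_at A p"
  shows "linear (frechet_derivative (coord_rep c d id) (at (snd c p)))"
  using linear_coord_derivative[OF smooth_manifoldD(2)[OF A], of c d p] assms by (simp add: charts_at_def)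

lemma tangent_of_in_tangent_space:
  assumes "c \<in> charts_at A p"
  shows "tangent_of A c p x \<in> tangent_space A p"
  by (auto simp: tangent_of_def tangent_space_def intro!: transition_comp[OF assms])

lemma tangent_of_self:
  assumes c: "c \<in> charts_at A p"
  shows "tangent_of A c p x c = x"
proof -
  note top = smooth_manifoldD(1)[OF A]
  have "((\<lambda>x. x) has_derivative (\<lambda>x. x)) (at (snd c p))" by (rule has_derivative_ident)
  then have "(coord_rep c c id has_derivative (\<lambda>x. x)) (at (snd c p))"
  proof (rule has_derivative_transform_within_open)
    show "open (snd c ` fst c)" by (rule top_atlas_chart(3)[OF top charts_atD(1)[OF c]])
    show "snd c p \<in> snd c ` fst c" using charts_atD(2)[OF c] by simp
    show "y = coord_rep c c id y" if "y \<in> snd c ` fst c" for y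
      using that by (rule imageE) (simp add: coord_rep_chart[OF top charts_atD(1)[OF c]])
  qed
  then show ?thesis using c by (simp add: tangent_of_def frechet_derivative_eq)
qed

lemma tangent_space_eqI:
  assumes "c \<in> charts_at A p" "v \<in> tangent_space A p" "w \<in> tangent_space A p" "v c = w c"
  shows "v = w"
proof
  fix d show "v d = w d"
    using tangent_space_transition[OF assms(2,1), of d] tangent_space_transition[OF assms(3,1), of d]
      tangent_space_outside[OF assms(2), of d] tangent_space_outside[OF assms(3), of d] assms(4)
    by metis
qed

lemma tangent_space_lincomb:
  assumes "\<And>i. i \<in> I \<Longrightarrow> v i \<in> tangent_space A p"
  shows "(\<lambda>c. \<Sum>i\<in>I. r i *\<^sub>R v i c) \<in> tangent_space A p"
proof (rule tangent_spaceI)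
  fix c d assume c: "c \<in> charts_at A p" and d: "d \<in> charts_at A p"
  show "(\<Sum>i\<in>I. r i *\<^sub>R v i d) =
      frechet_derivative (coord_rep c d id) (at (snd c p)) (\<Sum>i\<in>I. r i *\<^sub>R v i c)"
    unfolding linear_sum[OF linear_transition[OF c d]] linear_cmul[OF linear_transition[OF c d]]
    by (rule sum.cong[OF refl]) (simp only: tangent_space_transition[OF assms c d])
next
  fix c assume "c \<notin> charts_at A p"
  then show "(\<Sum>i\<in>I. r i *\<^sub>R v i c) = 0" using tangent_space_outside[OF assms] by simp
qed

lemma tangent_space_add:
  assumes "v \<in> tangent_space A p" "w \<in> tangent_space A p"
  shows "(\<lambda>c. v c + w c) \<in> tangent_space A p"
  using tangent_space_lincomb[of "UNIV :: bool set" "\<lambda>b. if b then v else w" p "\<lambda>_. 1"] assms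
  by (simp add: UNIV_bool add.commute)

lemma tangent_space_diff:
  assumes "v \<in> tangent_space A p" "w \<in> tangent_space A p"
  shows "(\<lambda>c. v c - w c) \<in> tangent_space A p"
  using tangent_space_lincomb[of "UNIV :: bool set" "\<lambda>b. if b then v else w" p "\<lambda>b. if b then 1 else - 1"] assms
  by (simp add: UNIV_bool)

end

text \<open>
  The definition of the differential picks a chart around \<open>p\<close>; by the chain rule every other one gives
  the same.
\<close>

lemma pushforward_component:
  assumes A: "smooth_manifold A" and B: "smooth_manifold B" and f: "smooth_map A B f"
    and v: "v \<in> tangent_space A p" and c: "c \<in> charts_at A p" and d: "d \<in> charts_at B (f p)"
  shows "pushforward A B f p v d = frechet_derivative (coord_rep c d f) (at (snd c p)) (v c)"
proof -
  define c' where "c' = (SOME c. c \<in> charts_at A p)"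
  have c': "c' \<in> charts_at A p" unfolding c'_def using c by (rule someI)
  have "v c = frechet_derivative (coord_rep c' c id) (at (snd c' p)) (v c')"
    by (rule tangent_space_transition[OF v c' c])
  moreover have "frechet_derivative (coord_rep c' d f) (at (snd c' p)) w =
      frechet_derivative (coord_rep c d f) (at (snd c p)) (frechet_derivative (coord_rep c' c id) (at (snd c' p)) w)" for w
    using coord_derivative_comp[OF smooth_manifoldD(1)[OF A] smooth_manifoldD(1)[OF A]
        smooth_manifoldD(2)[OF A] f, of c' c d p] c c' d
    by (simp add: charts_at_def)
  ultimately show ?thesis using d by (simp add: pushforward_def c'_def[symmetric])
qed

lemma pushforward_in_tangent_space:
  assumes A: "smooth_manifold A" and B: "smooth_manifold B" and f: "smooth_map A B f"
    and v: "v \<in> tangent_space A p"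
  shows "pushforward A B f p v \<in> tangent_space B (f p)"
proof -
  obtain c where c: "c \<in> charts_at A p" using obtain_chart_at[OF smooth_manifoldD(1)[OF A]] .
  show ?thesis
  proof (rule tangent_spaceI)
    fix d e assume d: "d \<in> charts_at B (f p)" and e: "e \<in> charts_at B (f p)"
    have "frechet_derivative (coord_rep c e f) (at (snd c p)) (v c) =
        frechet_derivative (coord_rep d e id) (at (snd d (f p)))
          (frechet_derivative (coord_rep c d f) (at (snd c p)) (v c))"
      using coord_derivative_comp[OF smooth_manifoldD(1)[OF A] smooth_manifoldD(1)[OF B] f
          smooth_manifoldD(2)[OF B], of c d e p] c d e
      by (simp add: charts_at_def)
    then show "pushforward A B f p v e =
        frechet_derivative (coord_rep d e id) (at (snd d (f p))) (pushforward A B f p v d)"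
      by (simp only: pushforward_component[OF A B f v c d] pushforward_component[OF A B f v c e])
  qed (simp add: pushforward_def)
qed

lemma ctangent_space_eqI:
  assumes A: "smooth_manifold A" and c: "c \<in> charts_at A p"
    and v: "v \<in> ctangent_space A p" and w: "w \<in> ctangent_space A p"
    and eq: "(fst v c, snd v c) = (fst w c, snd w c)"
  shows "v = w"
proof (rule prod_eqI)
  show "fst v = fst w" "snd v = snd w"
    by (rule tangent_space_eqI[OF A c]; use v w eq in \<open>simp add: ctangent_space_def mem_Times_iff\<close>)+
qed

lemma ctlincomb_in_ctangent_space:
  assumes A: "smooth_manifold A" and w: "\<And>i. i < r \<Longrightarrow> w i \<in> ctangent_space A p"
  shows "ctlincomb r z w \<in> ctangent_space A p"
proof -
  have t: "fst (w i) \<in> tangent_space A p" "snd (w i) \<in> tangent_space A p" if "i < r" for i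
    using w[OF that] by (auto simp: ctangent_space_def)
  have "(\<lambda>c. \<Sum>i<r. Re (z i) *\<^sub>R fst (w i) c) \<in> tangent_space A p"
    "(\<lambda>c. \<Sum>i<r. Im (z i) *\<^sub>R snd (w i) c) \<in> tangent_space A p"
    "(\<lambda>c. \<Sum>i<r. Im (z i) *\<^sub>R fst (w i) c) \<in> tangent_space A p"
    "(\<lambda>c. \<Sum>i<r. Re (z i) *\<^sub>R snd (w i) c) \<in> tangent_space A p"
    using t by (auto intro!: tangent_space_lincomb[OF A])
  from tangent_space_diff[OF A this(1,2)] tangent_space_add[OF A this(3,4)]
  show ?thesis
    by (simp add: ctangent_space_def ctlincomb_def ctscale_def sum_subtractf sum.distrib)
qed

lemma ctlincomb_component:
  "(fst (ctlincomb r z w) c, snd (ctlincomb r z w) c) =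
    (\<Sum>i<r. complex_scale mult_i (z i) (fst (w i) c, snd (w i) c))"
  by (simp add: ctlincomb_def ctscale_def complex_scale_def mult_i_def prod_eq_iff fst_sum snd_sum add.commute)

section \<open>The pulled-back structure at a point\<close>

text \<open>
  The condition in one chart carries over to all others because the derivatives of the transition maps
  commute with the complex structure.
\<close>

lemma T10_iff_component:
  assumes Z: "complex_manifold Z" and d: "d \<in> charts_at Z p" and w: "w \<in> ctangent_space Z p"
  shows "w \<in> T10 Z p \<longleftrightarrow> fst w d = imult (snd w d)"
proof
  assume "w \<in> T10 Z p"
  then have "almost_complex (snd w) = snd (ctscale \<i> w)" by (simp add: T10_def prod_eq_iff)
  then show "fst w d = imult (snd w d)"
    by (auto simp: almost_complex_def ctscale_def dest!: fun_cong[of _ _ d])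
next
  assume eq: "fst w d = imult (snd w d)"
  have "fst w c = imult (snd w c)" for c
  proof (cases "c \<in> charts_at Z p")
    case True
    then have "fst w c = frechet_derivative (coord_rep d c id) (at (snd d p)) (fst w d)"
      "snd w c = frechet_derivative (coord_rep d c id) (at (snd d p)) (snd w d)"
      using w d True
      by (intro tangent_space_transition; simp add: ctangent_space_def mem_Times_iff)+
    then show ?thesis
      using holomorphic_map_derivative_imult[OF complex_manifold_holomorphic_id[OF Z], of d p c] d True
      by (simp add: eq)
  next
    case False
    then show ?thesis
      using tangent_space_outside[OF _ False, of "fst w"] tangent_space_outside[OF _ False, of "snd w"] w
      by (simp add: ctangent_space_def mem_Times_iff linear_0[OF linear_imult])
  qed
  then show "w \<in> T10 Z p"
    using w by (simp add: T10_def almost_complex_def ctscale_def prod_eq_iff fun_eq_iff imult_imult)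
qed

text \<open>
  The differential maps tangent vectors to tangent vectors, so only the eigenvalue equation is left, and
  that may be read off in one chart.
\<close>

lemma cpushforward_in_T10_iff:
  assumes N: "smooth_manifold N" and Z: "complex_manifold Z" and f: "smooth_map N Z f"
    and c: "c \<in> charts_at N p" and d: "d \<in> charts_at Z (f p)" and w: "w \<in> ctangent_space N p"
  shows "cpushforward N Z f p w \<in> T10 Z (f p) \<longleftrightarrow>
    antiholomorphic_part (frechet_derivative (coord_rep c d f) (at (snd c p))) (fst w c, snd w c) = 0"
proof -
  note Z' = complex_manifold_imp_smooth_manifold[OF Z]
  have t: "fst w \<in> tangent_space N p" "snd w \<in> tangent_space N p"
    using w by (auto simp: ctangent_space_def)
  then have "cpushforward N Z f p w \<in> ctangent_space Z (f p)"
    by (simp add: ctangent_space_def cpushforward_def pushforward_in_tangent_space[OF N Z' f])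
  from T10_iff_component[OF Z d this] show ?thesis
    by (simp add: cpushforward_def pushforward_component[OF N Z' f _ c d] t antiholomorphic_part_def)
qed

text \<open>
  \<^const>\<open>complex_dim\<close> halves the real dimension with rounding; as the latter is even, nothing is lost.
\<close>

lemma maximally_totally_real_dims:
  fixes N :: "('n, 'g::finite_dim_inner) chart set" and X :: "('x, 'e::complex_model) chart set"
    and Z :: "('z, 'f::complex_model) chart set"
  assumes "complex_dim X = m + k" "complex_dim Z = k" "real_dim N = complex_dim X"
  shows "2 * dim (UNIV :: 'g set) = dim (UNIV :: 'e set)"
    and "dim (UNIV :: ('g \<times> 'g) set) = 2 * m + dim (UNIV :: 'f set)"
  using assms even_dim_complex_model[where 'a='e] even_dim_complex_model[where 'a='f]
  by (auto simp: complex_dim_def real_dim_def dim_UNIV_prod)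

text \<open>
  Injectivity and total reality concern tangent vectors as wholes. They pass to the components in a single chart,
  since vectors that agree in one chart agree in all of them. For total reality this needs that \<open>J\<close>
  maps tangent vectors of \<open>X\<close> to tangent vectors.
\<close>

lemma maximally_totally_real_coord_derivative:
  fixes N :: "('n::{t2_space, second_countable_topology}, 'g::finite_dim_inner) chart set"
    and X :: "('x::{t2_space, second_countable_topology}, 'e::complex_model) chart set"
  assumes N: "smooth_manifold N" and X: "complex_manifold X"
    and \<phi>: "maximally_totally_real_immersion N X \<phi>"
    and c: "c \<in> charts_at N p" and e: "e \<in> charts_at X (\<phi> p)"
  shows "inj (frechet_derivative (coord_rep c e \<phi>) (at (snd c p)))" (is "inj ?A")
    and "frechet_derivative (coord_rep c e \<phi>) (at (snd c p)) a =
        imult (frechet_derivative (coord_rep c e \<phi>) (at (snd c p)) b) \<Longrightarrow>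
      frechet_derivative (coord_rep c e \<phi>) (at (snd c p)) a = 0"
proof -
  note X' = complex_manifold_imp_smooth_manifold[OF X]
  have sm: "smooth_map N X \<phi>" and inj: "inj_on (pushforward N X \<phi> p) (tangent_space N p)"
    and real: "totally_real (pushforward N X \<phi> p ` tangent_space N p)"
    using \<phi> by (auto simp: maximally_totally_real_immersion_def immersion_def)
  define v where "v a = pushforward N X \<phi> p (tangent_of N c p a)" for a
  have v: "v a \<in> tangent_space X (\<phi> p)" for a
    unfolding v_def by (rule pushforward_in_tangent_space[OF N X' sm tangent_of_in_tangent_space[OF N c]])
  have ve: "v a e = ?A a" for a
    unfolding v_def
    by (simp add: pushforward_component[OF N X' sm tangent_of_in_tangent_space[OF N c] c e]
        tangent_of_self[OF N c])
  show "inj ?A"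
  proof (rule injI)
    fix a b assume "?A a = ?A b"
    then have "v a = v b"
      by (intro tangent_space_eqI[OF X' e v v]) (simp add: ve)
    then have "tangent_of N c p a = tangent_of N c p b"
      using inj_onD[OF inj] tangent_of_in_tangent_space[OF N c] unfolding v_def by blast
    then show "a = b" by (metis tangent_of_self[OF N c])
  qed
  assume ab: "?A a = imult (?A b)"
  \<comment> \<open>The relation in the chart \<open>e\<close> spreads to all charts, on which total reality is stated.\<close>
  have "v a d = almost_complex (v b) d" for d
  proof (cases "d \<in> charts_at X (\<phi> p)")
    case True
    have "v a d = frechet_derivative (coord_rep e d id) (at (snd e (\<phi> p))) (imult (v b e))"
      using tangent_space_transition[OF v e True, of a] by (simp add: ve ab)
    also have "\<dots> = imult (frechet_derivative (coord_rep e d id) (at (snd e (\<phi> p))) (v b e))"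
      using holomorphic_map_derivative_imult[OF complex_manifold_holomorphic_id[OF X] e, of d] True
      by simp
    also have "\<dots> = imult (v b d)" using tangent_space_transition[OF v e True, of b] by simp
    finally show ?thesis by (simp add: almost_complex_def)
  next
    case False
    then show ?thesis
      by (simp add: tangent_space_outside[OF v] almost_complex_def linear_0[OF linear_imult])
  qed
  then have "v a = almost_complex (v b)" by blast
  moreover have "v a \<in> pushforward N X \<phi> p ` tangent_space N p" for a
    unfolding v_def by (intro imageI tangent_of_in_tangent_space[OF N c])
  ultimately have "v a \<in> {\<lambda>_. 0}"
    using real unfolding totally_real_def by blast
  then show "?A a = 0" unfolding ve[symmetric] by simp
qed

lemma submersion_coord_derivative_surj:
  assumes X: "complex_manifold X" and Z: "complex_manifold Z"
    and \<Psi>: "holomorphic_submersion X Z \<Psi>"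
    and e: "e \<in> charts_at X q" and d: "d \<in> charts_at Z (\<Psi> q)"
  shows "surj (frechet_derivative (coord_rep e d \<Psi>) (at (snd e q)))"
proof -
  note X' = complex_manifold_imp_smooth_manifold[OF X] and Z' = complex_manifold_imp_smooth_manifold[OF Z]
  have sm: "smooth_map X Z \<Psi>"
    and im: "pushforward X Z \<Psi> q ` tangent_space X q = tangent_space Z (\<Psi> q)"
    using \<Psi> holomorphic_map_imp_smooth_map by (auto simp: holomorphic_submersion_def)
  have "y \<in> range (frechet_derivative (coord_rep e d \<Psi>) (at (snd e q)))" for y
  proof -
    obtain v where v: "v \<in> tangent_space X q" "tangent_of Z d (\<Psi> q) y = pushforward X Z \<Psi> q v"
      using im tangent_of_in_tangent_space[OF Z' d] by blast
    have "y = frechet_derivative (coord_rep e d \<Psi>) (at (snd e q)) (v e)"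
      using pushforward_component[OF X' Z' sm v(1) e d] tangent_of_self[OF Z' d] v(2) by metis
    then show ?thesis by blast
  qed
  then show ?thesis by blast
qed

text \<open>
  With \<open>A\<close> the derivative of \<open>\<phi>\<close> and \<open>B\<close> the complex-linear derivative of \<open>\<Psi>\<close>, the map is
  \<open>(a, b) \<mapsto> B (A a - J (A b))\<close>. The argument of \<open>B\<close> takes every value, and \<open>B\<close> is onto.
\<close>

lemma antiholomorphic_part_surj:
  fixes N :: "('n::{t2_space, second_countable_topology}, 'g::finite_dim_inner) chart set"
    and X :: "('x::{t2_space, second_countable_topology}, 'e::complex_model) chart set"
    and Z :: "('z::{t2_space, second_countable_topology}, 'f::complex_model) chart set"
  assumes N: "smooth_manifold N" and X: "complex_manifold X" and Z: "complex_manifold Z"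
    and \<Psi>: "holomorphic_submersion X Z \<Psi>" and \<phi>: "maximally_totally_real_immersion N X \<phi>"
    and dim: "2 * dim (UNIV :: 'g set) = dim (UNIV :: 'e set)"
    and c: "c \<in> charts_at N p" and d: "d \<in> charts_at Z (\<Psi> (\<phi> p))"
  shows "surj (antiholomorphic_part (frechet_derivative (coord_rep c d (\<Psi> \<circ> \<phi>)) (at (snd c p))))"
proof -
  note X' = complex_manifold_imp_smooth_manifold[OF X] and Z' = complex_manifold_imp_smooth_manifold[OF Z]
  obtain e where e: "e \<in> charts_at X (\<phi> p)" by (rule obtain_chart_at[OF smooth_manifoldD(1)[OF X']])
  have \<phi>': "smooth_map N X \<phi>"
    using \<phi> by (simp add: maximally_totally_real_immersion_def immersion_def)
  have holo: "holomorphic_map X Z \<Psi>" using \<Psi> by (simp add: holomorphic_submersion_def)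
  note \<Psi>' = holomorphic_map_imp_smooth_map[OF holo]
  define A where "A = frechet_derivative (coord_rep c e \<phi>) (at (snd c p))"
  define B where "B = frechet_derivative (coord_rep e d \<Psi>) (at (snd e (\<phi> p)))"
  have AB: "frechet_derivative (coord_rep c d (\<Psi> \<circ> \<phi>)) (at (snd c p)) = (\<lambda>v. B (A v))"
    unfolding A_def B_def
    using c d e by (intro coord_derivative_comp[OF smooth_manifoldD(1)[OF N] smooth_manifoldD(1)[OF X'] \<phi>' \<Psi>'])
      (auto simp: charts_at_def)
  have linA: "linear A" and linB: "linear B"
    unfolding A_def B_def using c d e
    by (auto intro!: linear_coord_derivative[OF \<phi>'] linear_coord_derivative[OF \<Psi>'] simp: charts_at_def)
  have BJ: "B (imult v) = imult (B v)" for v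
    unfolding B_def by (rule holomorphic_map_derivative_imult[OF holo e d])
  have "y \<in> range (antiholomorphic_part (\<lambda>v. B (A v)))" for y
  proof -
    obtain x where x: "y = B x"
      using submersion_coord_derivative_surj[OF X Z \<Psi> e d] unfolding B_def[symmetric] by blast
    obtain a b where "x = A a - imult (A b)"
      by (rule totally_real_sum[OF linA _ _ dim])
        (use maximally_totally_real_coord_derivative[OF N X \<phi> c e] in \<open>auto simp: A_def\<close>)
    then have "y = antiholomorphic_part (\<lambda>v. B (A v)) (a, b)"
      by (simp add: x antiholomorphic_part_def linear_diff[OF linB] BJ)
    then show ?thesis by blast
  qed
  then show ?thesis unfolding AB by blast
qed

section \<open>Smooth fields and their brackets\<close>

text \<open>
  In another chart \<open>e\<close> the component of the field is \<open>D\<tau> y (\<sigma> y)\<close>, with \<open>\<tau>\<close> the transition map and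
  \<open>y\<close> the coordinates in \<open>c\<close>, which depend smoothly on the coordinates in \<open>e\<close>.
\<close>

lemma smooth_tfield_tangent_of:
  fixes A :: "('a::{t2_space, second_countable_topology}, 'e::finite_dim_inner) chart set"
  assumes A: "smooth_manifold A" and c: "c \<in> A"
    and T: "open T" and \<sigma>: "smooth_on T \<sigma>"
  shows "smooth_tfield A (fst c \<inter> snd c -` T) (\<lambda>q. tangent_of A c q (\<sigma> (snd c q)))"
  unfolding smooth_tfield_def
proof
  fix e assume e: "e \<in> A"
  note top = smooth_manifoldD(1)[OF A] and id = smooth_manifoldD(2)[OF A]
  let ?U = "fst c \<inter> snd c -` T"
  let ?W = "snd e ` (?U \<inter> fst e)"
  have W: "open ?W"
    by (intro open_chart_image[OF top e] open_Int open_chart_preimage[OF top c T]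
        top_atlas_chart(1)[OF top e]) auto
  have T': "open (T \<inter> coord_dom c e id)"
    by (intro open_Int T open_coord_dom[OF top top c e]) simp
  have component: "smooth_on (T \<inter> coord_dom c e id) (\<lambda>y. frechet_derivative (coord_rep c e id) (at y) (\<sigma> y))"
    by (rule smooth_on_derivative_apply[OF T' smooth_on_subset[OF smooth_mapD(2)[OF id c e] Int_lower2]
          smooth_on_subset[OF \<sigma> Int_lower1]])
  have transition: "smooth_on ?W (coord_rep e c id)"
    by (rule smooth_on_subset[OF smooth_mapD(2)[OF id e c]]) (auto simp: coord_dom_def)
  have "coord_rep e c id ` ?W \<subseteq> T \<inter> coord_dom c e id"
    by (auto simp: coord_rep_chart[OF top e] coord_dom_def)
  then have "smooth_on ?W
      (\<lambda>x. frechet_derivative (coord_rep c e id) (at (coord_rep e c id x)) (\<sigma> (coord_rep e c id x)))"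
    by (rule smooth_on_compose[OF W transition component])
  then show "smooth_on ?W (\<lambda>x. tangent_of A c (chart_inv e x) (\<sigma> (snd c (chart_inv e x))) e)"
  proof (rule smooth_on_cong[OF W, rotated])
    fix x assume "x \<in> ?W"
    then obtain q where q: "q \<in> fst c" "q \<in> fst e" "x = snd e q" by blast
    then show "frechet_derivative (coord_rep c e id) (at (coord_rep e c id x)) (\<sigma> (coord_rep e c id x)) =
        tangent_of A c (chart_inv e x) (\<sigma> (snd c (chart_inv e x))) e"
      using e by (simp add: chart_inv_chart[OF top e] coord_rep_chart[OF top e] tangent_of_def charts_at_def)
  qed
qed

lemma
  assumes A: "smooth_manifold A" and U: "open U"
    and "smooth_tfield A U V" "smooth_tfield A U W"
  shows smooth_tfield_add: "smooth_tfield A U (\<lambda>q c. V q c + W q c)"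
    and smooth_tfield_diff: "smooth_tfield A U (\<lambda>q c. V q c - W q c)"
proof -
  have "open (snd c ` (U \<inter> fst c))" if "c \<in> A" for c
    using that by (intro open_chart_image[OF smooth_manifoldD(1)[OF A]] open_Int U
        top_atlas_chart(1)[OF smooth_manifoldD(1)[OF A]]) auto
  then show "smooth_tfield A U (\<lambda>q c. V q c + W q c)" "smooth_tfield A U (\<lambda>q c. V q c - W q c)"
    using assms(3,4) by (auto simp: smooth_tfield_def intro!: smooth_on_add smooth_on_diff)
qed

lemma lie_bracket_coord:
  assumes "top_atlas A" "c \<in> A" "q \<in> fst c"
  shows "lie_bracket A V W q c =
    coord_bracket (\<lambda>x. V (chart_inv c x) c) (\<lambda>x. W (chart_inv c x) c) (snd c q)"
  using assms by (simp add: lie_bracket_def coord_bracket_def charts_at_def chart_inv_chart)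

lemma smooth_lie_bracket:
  fixes A :: "('a::{t2_space, second_countable_topology}, 'e::finite_dim_inner) chart set"
  assumes A: "smooth_manifold A" and U: "open U"
    and V: "smooth_tfield A U V" and W: "smooth_tfield A U W"
  shows "smooth_tfield A U (lie_bracket A V W)"
  unfolding smooth_tfield_def
proof
  note top = smooth_manifoldD(1)[OF A]
  fix c assume c: "c \<in> A"
  let ?S = "snd c ` (U \<inter> fst c)"
  have S: "open ?S"
    by (intro open_chart_image[OF top c] open_Int U top_atlas_chart(1)[OF top c]) auto
  have "smooth_on ?S (coord_bracket (\<lambda>x. V (chart_inv c x) c) (\<lambda>x. W (chart_inv c x) c))"
    using V W c by (intro smooth_coord_bracket[OF S]) (auto simp: smooth_tfield_def)
  then show "smooth_on ?S (\<lambda>x. lie_bracket A V W (chart_inv c x) c)"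
    by (rule smooth_on_cong[OF S, rotated])
      (auto simp: lie_bracket_coord[OF top c] chart_inv_chart[OF top c])
qed

text \<open>
  Let \<open>\<tau>\<close> be the transition map from \<open>c\<close> to \<open>d\<close>. The components of a field satisfy
  \<open>D\<tau> x (Y\<^sub>c x) = Y\<^sub>d (\<tau> x)\<close>, so differentiating the left side is, by the chain rule, differentiating the
  component in \<open>d\<close>. Then \<open>derivative_of_bracket\<close> with \<open>F = \<tau>\<close> says that \<open>D\<tau>\<close> takes the bracket in \<open>c\<close> to
  the bracket in \<open>d\<close>.
\<close>

lemma lie_bracket_in_tangent_space:
  fixes A :: "('a::{t2_space, second_countable_topology}, 'e::finite_dim_inner) chart set"
  assumes A: "smooth_manifold A" and U: "open U" "p \<in> U"
    and V: "smooth_tfield A U V" "\<And>q. q \<in> U \<Longrightarrow> V q \<in> tangent_space A q"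
    and W: "smooth_tfield A U W" "\<And>q. q \<in> U \<Longrightarrow> W q \<in> tangent_space A q"
  shows "lie_bracket A V W p \<in> tangent_space A p"
proof (rule tangent_spaceI)
  note top = smooth_manifoldD(1)[OF A] and id = smooth_manifoldD(2)[OF A]
  fix c d assume cd: "c \<in> charts_at A p" "d \<in> charts_at A p"
  note c = charts_atD[OF cd(1)] and d = charts_atD[OF cd(2)]
  define \<tau> where "\<tau> = coord_rep c d id"
  define S where "S = snd c ` (U \<inter> fst c \<inter> fst d)"
  have S: "open S"
    unfolding S_def
    by (intro open_chart_image[OF top c(1)] open_Int U top_atlas_chart(1)[OF top] c(1) d(1)) auto
  have pS: "snd c p \<in> S" using U c d by (auto simp: S_def)
  have \<tau>: "smooth_on S \<tau>"
    unfolding \<tau>_def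
    by (rule smooth_on_subset[OF smooth_mapD(2)[OF id c(1) d(1)]]) (auto simp: S_def coord_dom_def)
  have field_diff: "(\<lambda>x. Y (chart_inv e x) e) differentiable (at (snd e p))"
    if "smooth_tfield A U Y" "e \<in> A" "p \<in> fst e" for Y e
    using that U(2) smooth_on_has_derivative[of "snd e ` (U \<inter> fst e)" "\<lambda>x. Y (chart_inv e x) e" "snd e p"]
    by (auto simp: smooth_tfield_def differentiable_def)
  have \<tau>p: "\<tau> (snd c p) = snd d p" by (simp add: \<tau>_def coord_rep_chart[OF top c(1) c(2)])
  have related: "frechet_derivative (\<lambda>y. frechet_derivative \<tau> (at y) (Y (chart_inv c y) c)) (at (snd c p)) h =
      frechet_derivative (\<lambda>y. Y (chart_inv d y) d) (at (snd d p)) (frechet_derivative \<tau> (at (snd c p)) h)"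
    if Y: "smooth_tfield A U Y" "\<And>q. q \<in> U \<Longrightarrow> Y q \<in> tangent_space A q" for Y h
  proof -
    have "((\<lambda>y. Y (chart_inv d y) d) has_derivative
        frechet_derivative (\<lambda>y. Y (chart_inv d y) d) (at (snd d p))) (at (\<tau> (snd c p)))"
      using field_diff[OF Y(1) d] by (simp add: \<tau>p frechet_derivative_works)
    from has_derivative_compose[OF smooth_on_has_derivative[OF \<tau> pS] this]
    have "((\<lambda>y. frechet_derivative \<tau> (at y) (Y (chart_inv c y) c)) has_derivative
        (\<lambda>h. frechet_derivative (\<lambda>y. Y (chart_inv d y) d) (at (snd d p))
          (frechet_derivative \<tau> (at (snd c p)) h))) (at (snd c p))"
    proof (rule has_derivative_transform_within_open[OF _ S pS])
      fix x assume "x \<in> S"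
      then obtain q where q: "q \<in> U" "q \<in> fst c" "q \<in> fst d" "x = snd c q" by (auto simp: S_def)
      have "Y q d = frechet_derivative \<tau> (at (snd c q)) (Y q c)"
        unfolding \<tau>_def using q c(1) d(1)
        by (intro tangent_space_transition[OF Y(2)]) (auto simp: charts_at_def)
      then show "Y (chart_inv d (\<tau> x)) d = frechet_derivative \<tau> (at x) (Y (chart_inv c x) c)"
        using q by (simp add: \<tau>_def coord_rep_chart[OF top c(1)] chart_inv_chart[OF top c(1)]
            chart_inv_chart[OF top d(1)])
    qed
    then show ?thesis by (simp add: frechet_derivative_eq)
  qed
  have trans: "frechet_derivative \<tau> (at (snd c p)) (Y p c) = Y p d"
    if "\<And>q. q \<in> U \<Longrightarrow> Y q \<in> tangent_space A q" for Y
    unfolding \<tau>_def by (rule tangent_space_transition[OF that[OF U(2)] cd, symmetric])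
  have "frechet_derivative \<tau> (at (snd c p)) (lie_bracket A V W p c) =
      frechet_derivative (\<lambda>y. W (chart_inv d y) d) (at (snd d p)) (V p d) -
      frechet_derivative (\<lambda>y. V (chart_inv d y) d) (at (snd d p)) (W p d)"
    using derivative_of_bracket[OF S pS \<tau> field_diff[OF V(1) c] field_diff[OF W(1) c]]
      related[OF V] related[OF W]
    by (simp add: lie_bracket_coord[OF top c] coord_bracket_def chart_inv_chart[OF top c] trans[OF V(2)] trans[OF W(2)])
  then show "lie_bracket A V W p d =
      frechet_derivative (coord_rep c d id) (at (snd c p)) (lie_bracket A V W p c)"
    using cd by (simp add: lie_bracket_def \<tau>_def)
qed (simp add: lie_bracket_def)

section \<open>The pulled-back bundle is involutive\<close>

text \<open>
  Only the components in one chart \<open>c\<close> matter: there the fibres are the kernels of a smooth family, which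
  \<open>smooth_kernel_frame\<close> provides with a frame, and \<^const>\<open>tangent_of\<close> turns the components of this frame into
  sections.
\<close>

lemma pullback_T10_csubbundle:
  fixes N :: "('n::{t2_space, second_countable_topology}, 'g::finite_dim_inner) chart set"
    and Z :: "('z::{t2_space, second_countable_topology}, 'f::complex_model) chart set"
  assumes N: "smooth_manifold N" and Z: "complex_manifold Z" and f: "smooth_map N Z f"
    and surj: "\<And>p c d. c \<in> charts_at N p \<Longrightarrow> d \<in> charts_at Z (f p) \<Longrightarrow>
      surj (antiholomorphic_part (frechet_derivative (coord_rep c d f) (at (snd c p))))"
    and dim: "dim (UNIV :: ('g \<times> 'g) set) = 2 * m + dim (UNIV :: 'f set)"
  shows "smooth_csubbundle N (\<lambda>p. {w \<in> ctangent_space N p. cpushforward N Z f p w \<in> T10 Z (f p)}) m"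
    (is "smooth_csubbundle N ?P m")
  unfolding smooth_csubbundle_def
proof
  note top = smooth_manifoldD(1)[OF N]
    and topZ = smooth_manifoldD(1)[OF complex_manifold_imp_smooth_manifold[OF Z]]
  fix p
  obtain c where cp: "c \<in> charts_at N p" by (rule obtain_chart_at[OF top])
  obtain d where dp: "d \<in> charts_at Z (f p)" by (rule obtain_chart_at[OF topZ])
  note c = charts_atD[OF cp] and d = charts_atD[OF dp]
  define S where "S = coord_dom c d f"
  define F where "F = coord_rep c d f"
  define L where "L x = antiholomorphic_part (frechet_derivative F (at x))" for x
  have S: "open S" unfolding S_def by (rule open_coord_dom[OF top topZ c(1) d(1) smooth_mapD(1)[OF f]])
  have pS: "snd c p \<in> S" unfolding S_def using c d by (simp add: coord_domI)
  have F: "smooth_on S F" unfolding F_def S_def by (rule smooth_mapD(2)[OF f c(1) d(1)])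
  have linF: "linear (frechet_derivative F (at x))" if "x \<in> S" for x
    by (rule smooth_on_linear_derivative[OF F that])
  have smL: "smooth_on S (\<lambda>x. L x w)" for w
    unfolding L_def antiholomorphic_part_def
    by (rule smooth_on_diff[OF S smooth_on_frechet_derivative[OF F]
          smooth_on_linear[OF S linear_imp_bounded_linear[OF linear_imult] smooth_on_frechet_derivative[OF F]]])
  have J: "linear (\<lambda>y::'f. - imult y)" "- imult (- imult y) = - y" for y :: 'f
    using linear_compose_neg[OF linear_imult[where 'a='f]] linear_neg[OF linear_imult, of "imult y"]
    by (simp_all add: imult_imult)
  have LI: "L x (mult_i w) = - imult (L x w)" if "x \<in> S" for x w
    unfolding L_def by (rule antiholomorphic_part_mult_i[OF linF[OF that]])
  have linL: "linear (L x)" if "x \<in> S" for x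
    unfolding L_def by (rule linear_antiholomorphic_part[OF linF[OF that]])
  have surjL: "surj (L (snd c p))" unfolding L_def F_def by (rule surj[OF cp dp])
  obtain T \<sigma> where T: "open T" "snd c p \<in> T" "T \<subseteq> S" "\<And>i. smooth_on T (\<sigma> i)"
    and ker: "\<And>x w. x \<in> T \<Longrightarrow> L x w = 0 \<longleftrightarrow> (\<exists>z. w = (\<Sum>i<m. complex_scale mult_i (z i) (\<sigma> i x)))"
    and indep: "\<And>x z. x \<in> T \<Longrightarrow> (\<Sum>i<m. complex_scale mult_i (z i) (\<sigma> i x)) = 0 \<Longrightarrow> \<forall>i<m. z i = 0"
    using smooth_kernel_frame[where L = L and I = mult_i and J = "\<lambda>y. - imult y",
        OF S pS linL smL linear_mult_i mult_i_mult_i J LI surjL dim] by blast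
  define U where "U = fst c \<inter> snd c -` T"
  define s where "s i q = (tangent_of N c q (fst (\<sigma> i (snd c q))), tangent_of N c q (snd (\<sigma> i (snd c q))))"
    for i q
  have cU: "c \<in> charts_at N q" if "q \<in> U" for q using that c by (auto simp: U_def charts_at_def)
  have dU: "d \<in> charts_at Z (f q)" if q: "q \<in> U" for q
    using chart_in_coord_dom_iff[OF top c(1), of q d f] q T(3) d
    by (auto simp: U_def S_def charts_at_def)
  have s_tangent: "s i q \<in> ctangent_space N q" if "q \<in> U" for i q
    by (simp add: s_def ctangent_space_def tangent_of_in_tangent_space[OF N cU[OF that]])
  have s_component: "(fst (s i q) c, snd (s i q) c) = \<sigma> i (snd c q)" if "q \<in> U" for i q
    by (simp add: s_def tangent_of_self[OF N cU[OF that]])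
  have comb: "ctlincomb m z (\<lambda>i. s i q) \<in> ctangent_space N q" if "q \<in> U" for z q
    by (rule ctlincomb_in_ctangent_space[OF N s_tangent[OF that]])
  have comb_component: "(fst (ctlincomb m z (\<lambda>i. s i q)) c, snd (ctlincomb m z (\<lambda>i. s i q)) c) =
      (\<Sum>i<m. complex_scale mult_i (z i) (\<sigma> i (snd c q)))" if "q \<in> U" for z q
    unfolding ctlincomb_component by (simp only: s_component[OF that])
  have P: "w \<in> ?P q \<longleftrightarrow> w \<in> ctangent_space N q \<and> L (snd c q) (fst w c, snd w c) = 0" if "q \<in> U" for w q
    using cpushforward_in_T10_iff[OF N Z f cU[OF that] dU[OF that], of w] unfolding L_def F_def by blast
  have xT: "snd c q \<in> T" if "q \<in> U" for q using that by (simp add: U_def)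
  show "\<exists>U s. open U \<and> p \<in> U \<and>
      (\<forall>i<m. smooth_csection N (ctangent_space N) U (s i)) \<and>
      (\<forall>q\<in>U. ?P q = range (\<lambda>z. ctlincomb m z (\<lambda>i. s i q)) \<and>
         (\<forall>z. ctlincomb m z (\<lambda>i. s i q) = ctzero \<longrightarrow> (\<forall>i<m. z i = 0)))"
  proof (intro exI[of _ U] exI[of _ s] conjI allI impI ballI)
    show "open U" unfolding U_def by (rule open_chart_preimage[OF top c(1) T(1)])
    show "p \<in> U" using c T(2) by (simp add: U_def)
    show "smooth_csection N (ctangent_space N) U (s i)" for i
      unfolding smooth_csection_def
    proof (intro conjI ballI)
      show "s i q \<in> ctangent_space N q" if "q \<in> U" for q by (rule s_tangent[OF that])
      show "smooth_tfield N U (\<lambda>q. fst (s i q))" "smooth_tfield N U (\<lambda>q. snd (s i q))"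
        unfolding s_def U_def fst_conv snd_conv
        by (rule smooth_tfield_tangent_of[OF N c(1) T(1) smooth_on_linear[OF T(1) bounded_linear_fst T(4)]],
            rule smooth_tfield_tangent_of[OF N c(1) T(1) smooth_on_linear[OF T(1) bounded_linear_snd T(4)]])
    qed
  next
    fix q assume q: "q \<in> U"
    show "?P q = range (\<lambda>z. ctlincomb m z (\<lambda>i. s i q))"
    proof (rule set_eqI)
      fix w
      show "w \<in> ?P q \<longleftrightarrow> w \<in> range (\<lambda>z. ctlincomb m z (\<lambda>i. s i q))"
      proof
        assume w: "w \<in> ?P q"
        then obtain z where z: "(fst w c, snd w c) = (\<Sum>i<m. complex_scale mult_i (z i) (\<sigma> i (snd c q)))"
          using ker[OF xT[OF q], of "(fst w c, snd w c)"] unfolding P[OF q] by blast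
        have "w = ctlincomb m z (\<lambda>i. s i q)"
          by (rule ctangent_space_eqI[OF N cU[OF q] _ comb[OF q]])
            (use w in \<open>auto simp only: z comb_component[OF q]\<close>)
        then show "w \<in> range (\<lambda>z. ctlincomb m z (\<lambda>i. s i q))" by blast
      next
        assume "w \<in> range (\<lambda>z. ctlincomb m z (\<lambda>i. s i q))"
        then obtain z where w: "w = ctlincomb m z (\<lambda>i. s i q)" by blast
        have "L (snd c q) (fst w c, snd w c) = 0"
          unfolding ker[OF xT[OF q]] w comb_component[OF q] by blast
        then show "w \<in> ?P q" unfolding P[OF q] using comb[OF q] w by simp
      qed
    qed
  next
    fix q z i assume q: "q \<in> U" and z: "ctlincomb m z (\<lambda>i. s i q) = ctzero" and i: "i < m"
    have "(\<Sum>i<m. complex_scale mult_i (z i) (\<sigma> i (snd c q))) = 0"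
      unfolding comb_component[OF q, symmetric] z by (simp add: ctzero_def zero_prod_def)
    then show "z i = 0" using indep[OF xT[OF q]] i by blast
  qed
qed

text \<open>
  The brackets of the real and imaginary parts are smooth fields of tangent vectors; that they satisfy the
  equation of the kernel is \<open>antiholomorphic_part_bracket\<close> in charts.
\<close>

lemma pullback_T10_involutive:
  fixes N :: "('n::{t2_space, second_countable_topology}, 'g::finite_dim_inner) chart set"
    and Z :: "('z::{t2_space, second_countable_topology}, 'f::complex_model) chart set"
  assumes N: "smooth_manifold N" and Z: "complex_manifold Z" and f: "smooth_map N Z f"
    and P: "P = (\<lambda>p. {w \<in> ctangent_space N p. cpushforward N Z f p w \<in> T10 Z (f p)})"
    and U: "open U" and V: "smooth_csection N P U V" and W: "smooth_csection N P U W"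
  shows "smooth_csection N P U (clie_bracket N V W)"
proof -
  note top = smooth_manifoldD(1)[OF N]
    and topZ = smooth_manifoldD(1)[OF complex_manifold_imp_smooth_manifold[OF Z]]
  have sm: "smooth_tfield N U (\<lambda>q. fst (Y q))" "smooth_tfield N U (\<lambda>q. snd (Y q))"
    and PY: "q \<in> U \<Longrightarrow> Y q \<in> P q"
    and tan: "q \<in> U \<Longrightarrow> fst (Y q) \<in> tangent_space N q" "q \<in> U \<Longrightarrow> snd (Y q) \<in> tangent_space N q"
    if "smooth_csection N P U Y" for Y q
    using that by (auto simp: smooth_csection_def P ctangent_space_def mem_Times_iff)
  have fields: "smooth_tfield N U (\<lambda>q. fst (clie_bracket N V W q))"
    "smooth_tfield N U (\<lambda>q. snd (clie_bracket N V W q))"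
    by (auto simp: clie_bracket_def Let_def
        intro!: smooth_tfield_add[OF N U] smooth_tfield_diff[OF N U] smooth_lie_bracket[OF N U] sm V W)
  have "clie_bracket N V W q \<in> P q" if q: "q \<in> U" for q
  proof -
    have tangent: "clie_bracket N V W q \<in> ctangent_space N q"
      unfolding clie_bracket_def Let_def ctangent_space_def
      by (intro SigmaI tangent_space_diff[OF N] tangent_space_add[OF N]
          lie_bracket_in_tangent_space[OF N U q] sm[OF V] sm[OF W] tan[OF V] tan[OF W])
    obtain c where cq: "c \<in> charts_at N q" by (rule obtain_chart_at[OF top])
    obtain d where dq: "d \<in> charts_at Z (f q)" by (rule obtain_chart_at[OF topZ])
    note c = charts_atD[OF cq] and d = charts_atD[OF dq]
    define S where "S = snd c ` (U \<inter> fst c) \<inter> coord_dom c d f"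
    have S: "open S"
      unfolding S_def
      by (intro open_Int open_coord_dom[OF top topZ c(1) d(1) smooth_mapD(1)[OF f]]
          open_chart_image[OF top c(1)] U top_atlas_chart(1)[OF top c(1)]) auto
    have qS: "snd c q \<in> S" using q c d by (auto simp: S_def coord_dom_def)
    have F: "smooth_on S (coord_rep c d f)"
      by (rule smooth_on_subset[OF smooth_mapD(2)[OF f c(1) d(1)]]) (simp add: S_def)
    have coord_smooth: "smooth_on S (\<lambda>x. Y (chart_inv c x) c)" if "smooth_tfield N U Y" for Y
    proof (rule smooth_on_subset)
      show "smooth_on (snd c ` (U \<inter> fst c)) (\<lambda>x. Y (chart_inv c x) c)"
        using that c(1) by (auto simp: smooth_tfield_def)
    qed (simp add: S_def)
    have ker: "antiholomorphic_part (frechet_derivative (coord_rep c d f) (at x))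
        (fst (Y (chart_inv c x)) c, snd (Y (chart_inv c x)) c) = 0"
      if Y: "smooth_csection N P U Y" and x: "x \<in> S" for Y x
    proof -
      obtain r where r: "r \<in> U" "r \<in> fst c" "x = snd c r" using x by (auto simp: S_def)
      have "snd c r \<in> coord_dom c d f" using x r by (simp add: S_def)
      then have "f r \<in> fst d" by (simp only: chart_in_coord_dom_iff[OF top c(1) r(2)])
      then have "c \<in> charts_at N r" "d \<in> charts_at Z (f r)" using r c d by (auto simp: charts_at_def)
      from cpushforward_in_T10_iff[OF N Z f this, of "Y r"] PY[OF Y r(1)] show ?thesis
        by (simp add: P r(3) chart_inv_chart[OF top c(1) r(2)])
    qed
    have "antiholomorphic_part (frechet_derivative (coord_rep c d f) (at (snd c q)))
        (fst (clie_bracket N V W q) c, snd (clie_bracket N V W q) c) = 0"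
      unfolding clie_bracket_def Let_def fst_conv snd_conv lie_bracket_coord[OF top c]
      by (rule antiholomorphic_part_bracket[OF S qS F coord_smooth[OF sm(1)[OF V]] coord_smooth[OF sm(2)[OF V]]
            coord_smooth[OF sm(1)[OF W]] coord_smooth[OF sm(2)[OF W]] ker[OF V] ker[OF W]])
    then show ?thesis
      using tangent cpushforward_in_T10_iff[OF N Z f cq dq tangent] by (simp add: P)
  qed
  then show ?thesis using fields by (simp add: smooth_csection_def)
qed

theorem theorem3p3:
  fixes X :: "('x::{t2_space, second_countable_topology}, 'e::complex_model) chart set"
    and Z :: "('z::{t2_space, second_countable_topology}, 'f::complex_model) chart set"
    and N :: "('n::{t2_space, second_countable_topology}, 'g::finite_dim_inner) chart set"
    and \<Psi> :: "'x \<Rightarrow> 'z" and \<phi> :: "'n \<Rightarrow> 'x" and m k :: nat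
  assumes "complex_manifold X" and "complex_dim X = m + k"
    and "complex_manifold Z" and "complex_dim Z = k"
    and "holomorphic_submersion X Z \<Psi>"
    and "smooth_manifold N"
    and "maximally_totally_real_immersion N X \<phi>"
  shows "let \<psi> = \<Psi> \<circ> \<phi>;
             P = (\<lambda>p. {w \<in> ctangent_space N p. cpushforward N Z \<psi> p w \<in> T10 Z (\<psi> p)})
         in involutive_structure N P m"
proof -
  note X = assms(1) and Z = assms(3) and \<Psi> = assms(5) and N = assms(6) and \<phi> = assms(7)
  note X' = complex_manifold_imp_smooth_manifold[OF X] and Z' = complex_manifold_imp_smooth_manifold[OF Z]
  have smooth: "smooth_map N X \<phi>" "smooth_map X Z \<Psi>" and "real_dim N = complex_dim X"
    using \<phi> \<Psi> by (auto simp: maximally_totally_real_immersion_def immersion_def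
        holomorphic_submersion_def intro: holomorphic_map_imp_smooth_map)
  note dims = maximally_totally_real_dims[OF assms(2,4) this(3)]
  have \<psi>: "smooth_map N Z (\<Psi> \<circ> \<phi>)"
    by (rule smooth_map_comp[OF smooth_manifoldD(1)[OF N] smooth_manifoldD(1)[OF X']
          smooth_manifoldD(1)[OF Z'] smooth])
  define P where "P = (\<lambda>p. {w \<in> ctangent_space N p. cpushforward N Z (\<Psi> \<circ> \<phi>) p w \<in> T10 Z ((\<Psi> \<circ> \<phi>) p)})"
  have "smooth_csubbundle N P m"
    unfolding P_def
    by (rule pullback_T10_csubbundle[OF N Z \<psi> _ dims(2)])
      (simp only: comp_apply, rule antiholomorphic_part_surj[OF N X Z \<Psi> \<phi> dims(1)])
  moreover have "smooth_csection N P U (clie_bracket N V W)"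
    if "open U" "smooth_csection N P U V" "smooth_csection N P U W" for U V W
    by (rule pullback_T10_involutive[OF N Z \<psi> P_def that])
  ultimately have "involutive_structure N P m" by (simp add: involutive_structure_def)
  then show ?thesis by (simp add: P_def Let_def)
qed

end
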